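(* For every $\varepsilon,\lambda,\eta\in(0,1)$ there exists $\tau\in(0,1)$ such that for all positive integers $s\le n$ and all $\delta\le\tau$, the problem $\mathrm{PolyEval}_{n,s}$ has a $(O(\mathrm{polylog}\, s\cdot\log^{1+o(1)}n),\delta,\varepsilon,\lambda)$-data structure of length $O((s\log n)^{1+\eta})$.
   Context: A data structure problem is a function $f:D\times Q\to A$ ($D$ = data items, $Q$ = queries, $A$ = answers). For an integer $t>0$, $\delta\in[0,1]$, $\varepsilon\in[0,1/2]$, $\lambda\in[0,1]$, $f$ has a $(t,\delta,\varepsilon,\lambda)$-data structure of length $N$ if there exist an encoder $\mathcal{E}:D\to\{0,1\}^N$ and a randomized decoder $\mathcal{D}$ which, given a query $q$ and oracle (bit-probe) access to a string $w\in\{0,1\}^N$, outputs an element of $A\cup\{\perp\}$ (where $\perp$ means "don't know"), such that for every $x\in D$ and every $w\in\{0,1\}^N$ with Hamming distance $\Delta(w,\mathcal{E}(x))\le\delta N$: (1) $\mathcal{D}$ makes at most $t$ bit-probes to $w$; (2) $\Pr[\mathcal{D}^w(q)\in\{f(x,q),\perp\}]\ge 1-\varepsilon$ for every $q\in Q$; (3) the set $G=\{q:\Pr[\mathcal{D}^w(q)=f(x,q)]\ge 1-\varepsilon\}$ has size at least $(1-\lambda)|Q|$; (4) if $w=\mathcal{E}(x)$ then $G=Q$. The univariate polynomial evaluation problem $\mathrm{PolyEval}_{n,s}$ has $D=\{g\in\mathbb{Z}_n[X]:\deg g\le s\}$, $Q=\mathbb{Z}_n$, $A=\mathbb{Z}_n$,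 and $\mathrm{PolyEval}_{n,s}(g,a)=g(a)$, where $\mathbb{Z}_n$ denotes the integers modulo $n$. Asymptotic notation is in terms of $s,n$, with constants depending on $\varepsilon,\lambda,\eta$. Logarithms are base 2. *)

theory Defs
  imports "HOL-Probability.Probability" "HOL-Computational_Algebra.Polynomial"
begin

definition hamming_dist :: "bool list \<Rightarrow> bool list \<Rightarrow> nat" where
  "hamming_dist v w = card {i. i < length v \<and> v ! i \<noteq> w ! i}"

text \<open>
  A randomized bit-probe algorithm is a probability distribution over deterministic adaptive ones,
  i.e. over binary decision trees: \<open>Probe i T0 T1\<close> reads bit \<open>i\<close> of the oracle string and continues
  with \<open>T0\<close> or \<open>T1\<close>.  The output \<open>None\<close> is the answer "don't know".
\<close>

datatype 'a decision_tree =
    Output "'a option"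
  | Probe nat "'a decision_tree" "'a decision_tree"

primrec dt_run :: "bool list \<Rightarrow> 'a decision_tree \<Rightarrow> 'a option" where
  "dt_run w (Output a) = a"
| "dt_run w (Probe i T0 T1) = (if w ! i then dt_run w T1 else dt_run w T0)"

primrec dt_num_probes :: "bool list \<Rightarrow> 'a decision_tree \<Rightarrow> nat" where
  "dt_num_probes w (Output a) = 0"
| "dt_num_probes w (Probe i T0 T1) =
     Suc (if w ! i then dt_num_probes w T1 else dt_num_probes w T0)"

primrec dt_valid :: "nat \<Rightarrow> 'a set \<Rightarrow> 'a decision_tree \<Rightarrow> bool" where
  "dt_valid N A (Output a) \<longleftrightarrow> set_option a \<subseteq> A"
| "dt_valid N A (Probe i T0 T1) \<longleftrightarrow> i < N \<and> dt_valid N A T0 \<and> dt_valid N A T1"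

type_synonym ('q, 'a) decoder = "'q \<Rightarrow> 'a decision_tree pmf"

definition decode :: "('q, 'a) decoder \<Rightarrow> bool list \<Rightarrow> 'q \<Rightarrow> 'a option pmf" where
  "decode Dec w q = map_pmf (dt_run w) (Dec q)"

definition good_queries ::
    "'q set \<Rightarrow> ('q \<Rightarrow> 'a) \<Rightarrow> ('q, 'a) decoder \<Rightarrow> bool list \<Rightarrow> real \<Rightarrow> 'q set" where
  "good_queries Q g Dec w \<epsilon> = {q \<in> Q. measure_pmf.prob (decode Dec w q) {Some (g q)} \<ge> 1 - \<epsilon>}"

definition has_data_structure ::
    "'d set \<Rightarrow> 'q set \<Rightarrow> 'a set \<Rightarrow> ('d \<Rightarrow> 'q \<Rightarrow> 'a) \<Rightarrow>
     nat \<Rightarrow> real \<Rightarrow> real \<Rightarrow> real \<Rightarrow> nat \<Rightarrow> bool" where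
  "has_data_structure D Q A f t \<delta> \<epsilon> lam N \<longleftrightarrow>
     (\<exists>(Enc :: 'd \<Rightarrow> bool list) (Dec :: ('q, 'a) decoder).
        (\<forall>x\<in>D. length (Enc x) = N) \<and>
        (\<forall>q\<in>Q. \<forall>T\<in>set_pmf (Dec q). dt_valid N A T) \<and>
        (\<forall>x\<in>D. \<forall>w. length w = N \<and> real (hamming_dist w (Enc x)) \<le> \<delta> * real N \<longrightarrow>
           (\<forall>q\<in>Q. \<forall>T\<in>set_pmf (Dec q). dt_num_probes w T \<le> t) \<and>
           (\<forall>q\<in>Q. measure_pmf.prob (decode Dec w q) {Some (f x q), None} \<ge> 1 - \<epsilon>) \<and>
           real (card (good_queries Q (f x) Dec w \<epsilon>)) \<ge> (1 - lam) * real (card Q) \<and>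
           (w = Enc x \<longrightarrow> good_queries Q (f x) Dec w \<epsilon> = Q)))"

text \<open>
  The ring of integers modulo \<open>n\<close> is represented by the residues \<open>{0..<n}\<close>, and its polynomials by
  the integer polynomials all of whose coefficients lie in that set.
\<close>

definition Zmod :: "nat \<Rightarrow> int set" where
  "Zmod n = {0..<int n}"

definition Zmod_polys :: "nat \<Rightarrow> nat \<Rightarrow> int poly set" where
  "Zmod_polys n s = {g. degree g \<le> s \<and> (\<forall>i. coeff g i \<in> Zmod n)}"

definition poly_eval_mod :: "nat \<Rightarrow> int poly \<Rightarrow> int \<Rightarrow> int" where
  "poly_eval_mod n g a = poly g a mod int n"

definition PolyEval_has_data_structure ::
    "nat \<Rightarrow> nat \<Rightarrow> nat \<Rightarrow> real \<Rightarrow> real \<Rightarrow> real \<Rightarrow> nat \<Rightarrow> bool" where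
  "PolyEval_has_data_structure n s t \<delta> \<epsilon> lam N \<longleftrightarrow>
     has_data_structure (Zmod_polys n s) (Zmod n) (Zmod n) (poly_eval_mod n) t \<delta> \<epsilon> lam N"

end

theory Submission
  imports Defs "HOL-Number_Theory.Cong" "HOL-Real_Asymp.Real_Asymp"
begin

text \<open>
  Write the exponents of \<open>g\<close> in base \<open>d\<close>: then \<open>g(a)\<close> is the value of an \<open>m\<close>-variate polynomial of
  degree \<open>< d\<close> in each variable at the point \<open>(a, a^d, a^(d^2), ...)\<close>, where \<open>d^m > s\<close>. After
  reducing that point modulo \<open>n\<close>, its value over the integers is less than \<open>2^k\<close> with
  \<open>k = O(m d log n)\<close>, so it is determined by its residues modulo all numbers up to \<open>2 k\<close>, whose
  least common multiple exceeds \<open>2^k\<close>. Doing this a second time for each of these moduli leaves moduli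
  of size \<open>O(m d (log (m d) + log log n))\<close> only, and for these all values are tabulated
  (Kedlaya and Umans). With \<open>d\<close> a power of \<open>log s + log log n\<close> the table has
  \<open>(s log n)^(1 + \<eta>)\<close> bits, and a query reads \<open>polylog s * log^(1 + o(1)) n\<close> of them.

  The table is encoded by a Reed-Muller code over a prime field, concatenated with a small binary
  code. A table bit is recovered from the restriction of the code word to a random line through the
  corresponding point; reading logarithmically many lines and voting makes all table bits that a
  query needs correct with probability \<open>1 - \<epsilon>\<close>.
\<close>

section \<open>Least common multiples and primes\<close>

text \<open>The induction is \<open>1 / (k C(n, k)) = 1 / (k C(n - 1, k)) - 1 / ((k + 1) C(n, k + 1))\<close>.\<close>

lemma mult_binomial_dvd:
  fixes N :: nat
  assumes "1 \<le> k" and "\<And>i. 1 \<le> i \<Longrightarrow> i \<le> k + e \<Longrightarrow> i dvd N"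
  shows "k * ((k + e) choose k) dvd N"
  using assms
proof (induction e arbitrary: k)
  case 0
  then show ?case by simp
next
  case (Suc e)
  define A where "A = k * ((k + Suc e) choose k)"
  define X where "X = ((k + e) choose k)"
  define B where "B = k * X"
  define C where "C = Suc k * ((Suc k + e) choose Suc k)"
  have "B dvd N"
    unfolding B_def X_def by (rule Suc.IH) (use Suc.prems in auto)
  moreover have "C dvd N"
    unfolding C_def by (rule Suc.IH) (use Suc.prems in auto)
  ultimately obtain b c where bc: "N = B * b" "N = C * c" by (meson dvdE)
  have C: "C = (k + Suc e) * X"
    using binomial_absorption[of k "k + Suc e"] by (simp add: C_def X_def del: binomial_Suc_Suc)
  have "Suc e * ((k + Suc e) choose k) = (k + Suc e) * X"
    using binomial_absorb_comp[of "k + Suc e" k] by (simp add: X_def del: binomial_Suc_Suc)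
  then have A: "Suc e * A = k * (k + Suc e) * X"
    unfolding A_def by (metis mult.assoc mult.left_commute)
  have "int (Suc e) * (int A * (int b - int c)) = int (Suc e * A) * int b - int (Suc e * A) * int c"
    by (simp only: of_nat_mult algebra_simps)
  also have "\<dots> = int (k + Suc e) * int (B * b) - int k * int (C * c)"
    unfolding A C by (simp add: B_def algebra_simps)
  also have "\<dots> = int (Suc e) * int N"
    using bc by (simp add: algebra_simps)
  finally have "int N = int A * (int b - int c)" by (metis mult_cancel_left of_nat_eq_0_iff nat.distinct(1))
  then have "int A dvd int N" by simp
  then show ?case by (simp only: A_def of_nat_dvd_iff)
qed

text \<open>The preceding divisibility makes the least common multiple at least
  \<open>k * ((2 * k) choose k)\<close>. The lower bound on the central binomial coefficient turns
  this into \<open>4 ^ k / 2\<close>, which exceeds \<open>2 ^ k\<close> for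
  \<open>k \<ge> 2\<close>.\<close>

lemma two_power_less_Lcm:
  assumes "2 \<le> k"
  shows "2 ^ k < Lcm {1..2 * k :: nat}"
proof -
  have "k * ((k + k) choose k) dvd Lcm {1..2 * k}"
    by (rule mult_binomial_dvd) (use assms in auto)
  moreover have "Lcm {1..2 * k} \<noteq> 0" by (simp add: Lcm_0_iff)
  ultimately have le: "k * ((2 * k) choose k) \<le> Lcm {1..2 * k}"
    by (metis dvd_imp_le mult_2 not_gr_zero)
  have "4 ^ k / (2 * real k) \<le> real ((2 * k) choose k)"
    using central_binomial_lower_bound[of k] assms by simp
  then have "4 ^ k \<le> 2 * real (k * ((2 * k) choose k))"
    using assms by (simp add: field_simps)
  also have "\<dots> = real (2 * (k * ((2 * k) choose k)))" by simp
  finally have "(4::nat) ^ k \<le> 2 * (k * ((2 * k) choose k))"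
    by (metis of_nat_le_iff of_nat_numeral of_nat_power)
  moreover have "2 * 2 ^ k < (4::nat) ^ k"
  proof -
    have "(2::nat) ^ 1 < 2 ^ k" using assms by (intro power_strict_increasing) auto
    then have "2 * 2 ^ k < (2::nat) ^ k * 2 ^ k" by simp
    also have "\<dots> = 4 ^ k" by (simp add: power_mult_distrib[symmetric])
    finally show ?thesis .
  qed
  ultimately show ?thesis using le by linarith
qed

text \<open>The difference is divisible by every \<open>i\<close> up to \<open>2 * k\<close>, hence
  by their least common multiple, which is larger than either number.\<close>

lemma eq_if_eq_mod_all:
  fixes V V' :: nat
  assumes "V \<le> 2 ^ k" "V' \<le> 2 ^ k" "2 \<le> k" "\<And>i. i \<in> {1..2 * k} \<Longrightarrow> V mod i = V' mod i"
  shows "V = V'"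
proof -
  have *: "V = V'" if "V \<le> V'" "V' < Lcm {1..2 * k}" "\<And>i. i \<in> {1..2 * k} \<Longrightarrow> V mod i = V' mod i"
    for V V' :: nat
  proof -
    have "Lcm {1..2 * k} dvd V' - V"
      using that(1,3) by (intro Lcm_least) (metis mod_eq_dvd_iff_nat)
    then show ?thesis using that(1,2) by (meson diff_diff_cancel diff_le_self dvd_imp_le le_neq_implies_less leD less_imp_diff_less zero_less_diff)
  qed
  show ?thesis using *[of V V'] *[of V' V] assms two_power_less_Lcm[of k] by fastforce
qed

section \<open>Primes from a large least common multiple\<close>

lemma prime_power_dvd_Lcm:
  fixes p :: nat
  assumes "finite A" "prime p" "p ^ e dvd Lcm A" "0 \<notin> A" "e > 0"
  shows "\<exists>a\<in>A. p ^ e dvd a"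
  using assms
proof (induction A rule: finite_induct)
  case empty
  then show ?case by auto
next
  case (insert a A)
  have nz: "a \<noteq> 0" "Lcm A \<noteq> 0" using insert by (auto simp: Lcm_0_iff)
  moreover have "e \<le> multiplicity p (lcm a (Lcm A))"
    using insert.prems nz by (intro multiplicity_geI) (auto simp: prime_gt_1_nat lcm_eq_0_iff)
  ultimately have "p ^ e dvd a \<or> p ^ e dvd Lcm A"
    using multiplicity_lcm[of a "Lcm A" p] insert.prems
    by (auto simp: max_def multiplicity_dvd' split: if_splits)
  then show ?case using insert by auto
qed

text \<open>Otherwise all prime factors of \<open>Lcm {1..K}\<close> are at most \<open>x\<close>.
  There are then at most \<open>x\<close> of them, and each contributes a prime power dividing some
  number up to \<open>K\<close>, so the product is at most \<open>K ^ x\<close>.\<close>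

lemma exists_prime_between:
  assumes "0 < K" and "K ^ x < Lcm {1..K :: nat}"
  shows "\<exists>p. prime p \<and> x < p \<and> p \<le> K"
proof (rule ccontr)
  assume no: "\<not> ?thesis"
  define L where "L = Lcm {1..K}"
  have L0: "L \<noteq> 0" by (simp add: L_def Lcm_0_iff)
  have *: "p ^ multiplicity p L \<le> K \<and> p \<le> x" if p: "p \<in> prime_factors L" for p
  proof -
    have pp: "prime p" and e: "multiplicity p L > 0"
      using p by (auto simp: prime_factors_multiplicity)
    have "p ^ multiplicity p L dvd L" by (rule multiplicity_dvd)
    then obtain a where a: "a \<in> {1..K}" "p ^ multiplicity p L dvd a"
      using prime_power_dvd_Lcm[OF _ pp _ _ e, of "{1..K}"] by (auto simp: L_def)
    then have le: "p ^ multiplicity p L \<le> K" by (auto dest: dvd_imp_le)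
    moreover have "p \<le> p ^ multiplicity p L" using e pp
      by (simp add: prime_gt_0_nat self_le_power Suc_leI)
    ultimately show ?thesis using no pp by (metis le_trans not_le)
  qed
  have "L = (\<Prod>p\<in>prime_factors L. p ^ multiplicity p L)"
    using L0 by (simp add: prime_factorization_nat)
  also have "\<dots> \<le> (\<Prod>p\<in>prime_factors L. K)" by (rule prod_mono) (use * in auto)
  also have "\<dots> = K ^ card (prime_factors L)" by simp
  also have "\<dots> \<le> K ^ x"
  proof -
    have "prime_factors L \<subseteq> {1..x}"
      using * by (auto simp: prime_factors_multiplicity Suc_leI prime_gt_0_nat)
    then have "card (prime_factors L) \<le> x" using card_mono[of "{1..x}"] by force
    then show ?thesis using assms(1) by (simp add: power_increasing)
  qed
  finally show False using assms by (simp add: L_def)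
qed

section \<open>Iterated modular reduction\<close>

text \<open>The exponent vector is the base \<open>d\<close> expansion of \<open>e\<close>. Thus an
  \<open>m\<close>-variate polynomial of degree \<open>< d\<close> in each variable keeps the
  coefficient indices \<open>e < d ^ m\<close> of a univariate one.\<close>

definition monomial_at :: "nat \<Rightarrow> nat \<Rightarrow> nat \<Rightarrow> (nat \<Rightarrow> nat) \<Rightarrow> nat" where
  "monomial_at d m e x = (\<Prod>j<m. x j ^ ((e div d ^ j) mod d))"

definition digit_eval :: "nat \<Rightarrow> nat \<Rightarrow> (nat \<Rightarrow> nat) \<Rightarrow> (nat \<Rightarrow> nat) \<Rightarrow> nat" where
  "digit_eval d m c x = (\<Sum>e<d ^ m. c e * monomial_at d m e x)"

lemma digit_expansion: "e mod d ^ m = (\<Sum>j<m. (e div d ^ j) mod d * d ^ j)" for d e :: nat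
proof (induction m)
  case (Suc m)
  have "e mod d ^ Suc m = d ^ m * (e div d ^ m mod d) + e mod d ^ m"
    using mod_mult2_eq[of e "d ^ m" d] by (simp add: mult.commute)
  then show ?case using Suc by (simp add: mult.commute)
qed simp

lemma monomial_at_powers:
  assumes "e < d ^ m"
  shows "monomial_at d m e (\<lambda>j. a ^ (d ^ j)) = a ^ e"
proof -
  have "monomial_at d m e (\<lambda>j. a ^ (d ^ j)) = a ^ (\<Sum>j<m. (e div d ^ j) mod d * d ^ j)"
    by (simp add: monomial_at_def power_sum mult.commute flip: power_mult)
  then show ?thesis using assms by (simp flip: digit_expansion)
qed

lemma digit_eval_mod:
  "digit_eval d m (\<lambda>e. c e mod k) (\<lambda>j. x j mod k) mod k = digit_eval d m c x mod k"
proof -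
  have "[digit_eval d m (\<lambda>e. c e mod k) (\<lambda>j. x j mod k) = digit_eval d m c x] (mod k)"
    unfolding digit_eval_def monomial_at_def
    by (intro cong_sum cong_mult cong_prod cong_pow) (auto simp: cong_def)
  then show ?thesis by (simp add: cong_def)
qed

lemma digit_eval_mod_point:
  "digit_eval d m c (\<lambda>j. x j mod k) mod k = digit_eval d m c x mod k"
  using digit_eval_mod[of d m c k "\<lambda>j. x j mod k"] digit_eval_mod[of d m c k x] by simp

text \<open>Each monomial is a product of \<open>m\<close> powers below \<open>2 ^ (l * d)\<close>
  or equal to it, and \<open>d \<le> 2 ^ d\<close> bounds the number \<open>d ^ m\<close> of terms
  by \<open>2 ^ (m * d)\<close>.\<close>

lemma digit_eval_le:
  assumes c: "\<And>e. c e \<le> 2 ^ l" and x: "\<And>j. x j \<le> 2 ^ l" and "1 \<le> l" and "1 \<le> d"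
  shows "digit_eval d m c x \<le> 2 ^ (2 * (m * d + 1) * l)"
proof -
  have mon: "monomial_at d m e x \<le> 2 ^ (m * d * l)" for e
  proof -
    have "monomial_at d m e x \<le> (\<Prod>j<m. 2 ^ (l * d))"
      unfolding monomial_at_def
    proof (rule prod_mono, safe)
      fix j
      have "x j ^ (e div d ^ j mod d) \<le> (2 ^ l) ^ (e div d ^ j mod d)"
        by (rule power_mono[OF x]) simp
      also have "\<dots> \<le> (2 ^ l) ^ d"
        using assms by (intro power_increasing) (auto simp: less_imp_le)
      finally show "x j ^ (e div d ^ j mod d) \<le> 2 ^ (l * d)" by (simp add: power_mult)
    qed
    then show ?thesis by (simp add: mult_ac flip: power_mult)
  qed
  have "digit_eval d m c x \<le> (\<Sum>e<d ^ m. 2 ^ l * 2 ^ (m * d * l))"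
    unfolding digit_eval_def by (intro sum_mono mult_le_mono c mon)
  also have "\<dots> = d ^ m * 2 ^ (l + m * d * l)" by (simp add: power_add)
  also have "\<dots> \<le> (2 ^ d) ^ m * 2 ^ (l + m * d * l)"
    by (intro mult_le_mono power_mono) (auto simp: less_imp_le)
  also have "\<dots> = 2 ^ (d * m + (l + m * d * l))" by (simp add: power_add power_mult)
  also have "\<dots> \<le> 2 ^ (2 * (m * d + 1) * l)"
  proof (rule power_increasing)
    have "d * m * 1 \<le> d * m * l" by (rule mult_le_mono2) (rule assms)
    then have "d * m + (l + m * d * l) \<le> d * m * l + (l + m * d * l)" by simp
    also have "\<dots> \<le> 2 * (m * d + 1) * l" by (simp add: algebra_simps)
    finally show "d * m + (l + m * d * l) \<le> 2 * (m * d + 1) * l" .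
  qed simp
  finally show ?thesis .
qed

text \<open>One level of modular reduction. The moduli range up to twice the exponent in the size
  bound \<open>digit_eval_le\<close>, as \<open>eq_if_eq_mod_all\<close> requires.\<close>

lemma digit_eval_determined:
  assumes "\<And>e. c e \<le> 2 ^ l" "\<And>e. c' e \<le> 2 ^ l" "\<And>j. x j \<le> 2 ^ l" "1 \<le> l" "1 \<le> d"
    and eq: "\<And>k. k \<in> {1..4 * (m * d + 1) * l} \<Longrightarrow> digit_eval d m c x mod k = digit_eval d m c' x mod k"
  shows "digit_eval d m c x = digit_eval d m c' x"
proof (rule eq_if_eq_mod_all[where k = "2 * (m * d + 1) * l"])
  show "2 \<le> 2 * (m * d + 1) * l" using assms by (cases l) auto
  show "digit_eval d m c x \<le> 2 ^ (2 * (m * d + 1) * l)"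
    and "digit_eval d m c' x \<le> 2 ^ (2 * (m * d + 1) * l)"
    by (rule digit_eval_le; use assms in simp)+
  show "digit_eval d m c x mod k = digit_eval d m c' x mod k"
    if "k \<in> {1..2 * (2 * (m * d + 1) * l)}" for k
    by (rule eq) (use that in \<open>simp add: algebra_simps\<close>)
qed

text \<open>
  The value at \<open>z\<close> modulo \<open>k2\<close> of the polynomial reduced modulo \<open>k1\<close> is stored in unary: the bit with
  index \<open>(k1, k2, z, v)\<close> tells whether it is \<open>v\<close>.
\<close>

definition residue_bit ::
    "nat \<Rightarrow> nat \<Rightarrow> (nat \<Rightarrow> nat) \<Rightarrow> nat \<times> nat \<times> nat list \<times> nat \<Rightarrow> bool" where
  "residue_bit d m c = (\<lambda>(k1, k2, z, v). digit_eval d m (\<lambda>e. c e mod k1) ((!) z) mod k2 = v)"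

lemma digit_eval_cong:
  "(\<And>e. e < d ^ m \<Longrightarrow> c e = c' e) \<Longrightarrow> (\<And>j. j < m \<Longrightarrow> x j = y j) \<Longrightarrow> digit_eval d m c x = digit_eval d m c' y"
  by (simp add: digit_eval_def monomial_at_def)

definition residue_index :: "nat \<Rightarrow> nat \<Rightarrow> nat \<Rightarrow> (nat \<times> nat \<times> nat list \<times> nat) set" where
  "residue_index m K1 K2 = {1..K1} \<times> {1..K2} \<times> {z. set z \<subseteq> {..<K2} \<and> length z = m} \<times> {..<K2}"

text \<open>The points come from the query alone, so the probes are nonadaptive. For each pair of
  moduli every candidate value \<open>v\<close> of the residue is probed.\<close>

definition residue_probes ::
    "nat \<Rightarrow> nat \<Rightarrow> nat \<Rightarrow> (nat \<Rightarrow> nat) \<Rightarrow> (nat \<times> nat \<times> nat list \<times> nat) set" where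
  "residue_probes m K1 K2 x =
     (\<lambda>(k1, k2, v). (k1, k2, map (\<lambda>j. x j mod k1 mod k2) [0..<m], v)) ` ({1..K1} \<times> {1..K2} \<times> {..<K2})"

lemma card_residue_index:
  "finite (residue_index m K1 K2)" "card (residue_index m K1 K2) = K1 * K2 ^ (m + 2)"
proof -
  have *: "finite {z. set z \<subseteq> {..<K2} \<and> length z = m}"
    by (rule finite_lists_length_eq) simp
  then show "finite (residue_index m K1 K2)" by (simp add: residue_index_def)
  show "card (residue_index m K1 K2) = K1 * K2 ^ (m + 2)"
    using * by (simp add: residue_index_def card_cartesian_product card_lists_length_eq)
qed

lemma residue_probes:
  "residue_probes m K1 K2 x \<subseteq> residue_index m K1 K2"
  "card (residue_probes m K1 K2 x) \<le> K1 * K2 ^ 2"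
proof -
  have "j mod k2 < K2" if "1 \<le> k2" "k2 \<le> K2" for j k2 :: nat
    using that mod_less_divisor[of k2 j] by linarith
  then show "residue_probes m K1 K2 x \<subseteq> residue_index m K1 K2"
    by (fastforce simp: residue_probes_def residue_index_def)
  show "card (residue_probes m K1 K2 x) \<le> K1 * K2 ^ 2"
    unfolding residue_probes_def
    by (rule order.trans[OF card_image_le]) (simp_all add: card_cartesian_product power2_eq_square)
qed

text \<open>Two nested uses of \<open>digit_eval_determined\<close>: the outer one for numbers up to
  \<open>2 ^ l\<close> with moduli up to \<open>K1\<close>, the inner one for the residues modulo
  \<open>k1\<close>, which are at most \<open>2 ^ \<mu>\<close>, with moduli up to
  \<open>K2\<close>.\<close>

lemma residue_bits_determine:
  assumes c: "\<And>e. c e \<le> 2 ^ l" "\<And>e. c' e \<le> 2 ^ l" and x: "\<And>j. x j \<le> 2 ^ l"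
    and "1 \<le> l" and "1 \<le> d"
    and K1: "K1 = 4 * (m * d + 1) * l" "K1 \<le> 2 ^ \<mu>" and K2: "K2 = 4 * (m * d + 1) * \<mu>"
    and eq: "\<And>i. i \<in> residue_probes m K1 K2 x \<Longrightarrow> residue_bit d m c i = residue_bit d m c' i"
  shows "digit_eval d m c x = digit_eval d m c' x"
proof (rule digit_eval_determined)
  fix k1 assume "k1 \<in> {1..4 * (m * d + 1) * l}"
  then have k1: "k1 \<in> {1..K1}" by (simp add: K1)
  have mu: "1 \<le> \<mu>"
  proof (rule ccontr)
    assume "\<not> 1 \<le> \<mu>"
    then have "4 * (m * d + 1) * l \<le> 1" using K1 by (auto simp: not_le)
    then show False using \<open>1 \<le> l\<close> by (cases l) auto
  qed
  have le: "j mod k1 \<le> 2 ^ \<mu>" for j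
    using k1 K1(2) mod_less_divisor[of k1 j] by (simp del: mod_less_divisor)
  have "digit_eval d m (\<lambda>e. c e mod k1) (\<lambda>j. x j mod k1) = digit_eval d m (\<lambda>e. c' e mod k1) (\<lambda>j. x j mod k1)"
  proof (rule digit_eval_determined)
    fix k2 assume "k2 \<in> {1..4 * (m * d + 1) * \<mu>}"
    then have k2: "k2 \<in> {1..K2}" by (simp add: K2)
    let ?z = "map (\<lambda>j. x j mod k1 mod k2) [0..<m]"
    have z: "digit_eval d m c ((!) ?z) mod k2 = digit_eval d m c (\<lambda>j. x j mod k1) mod k2" for c
    proof -
      have "digit_eval d m c ((!) ?z) = digit_eval d m c (\<lambda>j. x j mod k1 mod k2)"
        by (rule digit_eval_cong) auto
      then show ?thesis by (simp add: digit_eval_mod_point)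
    qed
    \<comment> \<open>The unary bit at the true residue for \<open>c\<close> is set; since it is
      also set for \<open>c'\<close>, the two residues coincide.\<close>
    let ?v = "digit_eval d m (\<lambda>e. c e mod k1) (\<lambda>j. x j mod k1) mod k2"
    have "?v < K2" using k2 mod_less_divisor[of k2] by (meson atLeastAtMost_iff less_le_trans less_one linorder_not_less order_less_le_trans)
    then have "(k1, k2, ?z, ?v) \<in> residue_probes m K1 K2 x"
      using k1 k2 unfolding residue_probes_def by force
    from eq[OF this] show "?v = digit_eval d m (\<lambda>e. c' e mod k1) (\<lambda>j. x j mod k1) mod k2"
      by (simp only: residue_bit_def prod.case z simp_thms)
  qed (use mu \<open>1 \<le> d\<close> le in auto)
  then show "digit_eval d m c x mod k1 = digit_eval d m c' x mod k1"
    by (metis digit_eval_mod)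
qed (use assms in auto)

section \<open>Polynomial evaluation from residue bits\<close>

definition coeff_nat :: "int poly \<Rightarrow> nat \<Rightarrow> nat" where
  "coeff_nat g e = nat (coeff g e)"

definition power_point :: "nat \<Rightarrow> nat \<Rightarrow> int \<Rightarrow> nat \<Rightarrow> nat" where
  "power_point n d a j = nat a ^ (d ^ j) mod n"

text \<open>Kronecker substitution read backwards: at \<open>(a, a^d, a^(d^2), ...)\<close> the
  monomial with the digits of \<open>e\<close> takes the value \<open>a ^ e\<close>. Reducing the
  coordinates modulo \<open>n\<close> keeps the value modulo \<open>n\<close> and makes the integers
  small.\<close>

lemma poly_eval_mod_eq:
  assumes g: "g \<in> Zmod_polys n s" and a: "a \<in> Zmod n" and s: "s < d ^ m"
  shows "poly_eval_mod n g a = int (digit_eval d m (coeff_nat g) (power_point n d a) mod n)"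
proof -
  have cn: "int (coeff_nat g e) = coeff g e" for e
    using g by (simp add: coeff_nat_def Zmod_polys_def Zmod_def)
  have "digit_eval d m (coeff_nat g) (power_point n d a) mod n
      = digit_eval d m (coeff_nat g) (\<lambda>j. nat a ^ (d ^ j)) mod n"
    unfolding power_point_def by (rule digit_eval_mod_point)
  also have "digit_eval d m (coeff_nat g) (\<lambda>j. nat a ^ (d ^ j)) = (\<Sum>e<d ^ m. coeff_nat g e * nat a ^ e)"
    by (simp add: digit_eval_def monomial_at_powers)
  finally have 1: "int (digit_eval d m (coeff_nat g) (power_point n d a) mod n)
      = (\<Sum>e<d ^ m. coeff g e * a ^ e) mod int n"
    using a by (simp add: cn zmod_int Zmod_def)
  have "(\<Sum>e<d ^ m. coeff g e * a ^ e) = (\<Sum>e\<le>degree g. coeff g e * a ^ e)"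
    using g s by (intro sum.mono_neutral_right) (auto simp: Zmod_polys_def coeff_eq_0)
  with 1 show ?thesis by (simp add: poly_eval_mod_def poly_altdef)
qed

text \<open>Correctness in the form the decoder uses: it answers with the value of any polynomial
  that agrees with the stored one on the probed bits, so no reconstruction procedure is
  required.\<close>

lemma poly_eval_determined:
  assumes "g \<in> Zmod_polys n s" "g' \<in> Zmod_polys n s" "a \<in> Zmod n" "s < d ^ m"
    and "n \<le> 2 ^ l" "1 \<le> l" "1 \<le> d"
    and "K1 = 4 * (m * d + 1) * l" "K1 \<le> 2 ^ \<mu>" and "K2 = 4 * (m * d + 1) * \<mu>"
    and "\<And>i. i \<in> residue_probes m K1 K2 (power_point n d a) \<Longrightarrow>
           residue_bit d m (coeff_nat g) i = residue_bit d m (coeff_nat g') i"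
  shows "poly_eval_mod n g a = poly_eval_mod n g' a"
proof -
  have n: "n > 0" using assms(3) by (auto simp: Zmod_def)
  have "coeff_nat g e \<le> 2 ^ l" if "g \<in> Zmod_polys n s" for g e
  proof -
    have "0 \<le> coeff g e" "coeff g e < int n"
      using that by (auto simp: Zmod_polys_def Zmod_def)
    then have "coeff_nat g e < n" by (simp add: coeff_nat_def nat_less_iff)
    then show ?thesis using assms(5) by simp
  qed
  moreover have "power_point n d a j \<le> 2 ^ l" for j
    using assms(5) n mod_less_divisor[of n] unfolding power_point_def
    by (meson less_imp_le order.trans)
  ultimately have "digit_eval d m (coeff_nat g) (power_point n d a) = digit_eval d m (coeff_nat g') (power_point n d a)"
    using assms by (intro residue_bits_determine[where l = l and ?K1.0 = K1 and \<mu> = \<mu> and ?K2.0 = K2]) auto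
  then show ?thesis using assms by (simp add: poly_eval_mod_eq)
qed

section \<open>A smooth locally decodable code\<close>

text \<open>
  The positions \<open>pos i y l\<close> with \<open>l\<close> in \<open>L\<close> form the line in direction \<open>y\<close> used to decode bit \<open>i\<close>.
  The code words of two messages that differ at \<open>i\<close> are far apart on each such line, and for random \<open>y\<close>
  and \<open>l\<close> the position \<open>pos i y l\<close> is uniformly distributed, so that few lines carry many errors.
\<close>

definition smooth_code ::
    "'i set \<Rightarrow> 'j set \<Rightarrow> 'l set \<Rightarrow> 'y set \<Rightarrow> (('i \<Rightarrow> bool) \<Rightarrow> 'j \<Rightarrow> bool) \<Rightarrow> ('i \<Rightarrow> 'y \<Rightarrow> 'l \<Rightarrow> 'j) \<Rightarrow> bool" where
  "smooth_code I J L Y enc pos \<longleftrightarrow>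
     finite J \<and> J \<noteq> {} \<and> finite L \<and> L \<noteq> {} \<and> finite Y \<and> Y \<noteq> {} \<and>
     (\<forall>i\<in>I. \<forall>y\<in>Y. \<forall>l\<in>L. pos i y l \<in> J) \<and>
     (\<forall>i\<in>I. \<forall>y\<in>Y. \<forall>x x'. x i \<noteq> x' i \<longrightarrow>
        card L \<le> 4 * card {l \<in> L. enc x (pos i y l) \<noteq> enc x' (pos i y l)}) \<and>
     (\<forall>i\<in>I. \<forall>j\<in>J. card J * card {(y, l). y \<in> Y \<and> l \<in> L \<and> pos i y l = j} \<le> card Y * card L)"

section \<open>Polynomials modulo a prime\<close>

lemma eq_if_dvd_diff:
  fixes a b q :: int
  assumes "q dvd a - b" "0 \<le> a" "a < q" "0 \<le> b" "b < q"
  shows "a = b"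
  using assms by (metis mod_eq_dvd_iff mod_pos_pos_trivial)

text \<open>Induction on \<open>D\<close>: synthetic division by the monic factor of a root
  \<open>a\<close> stays within the integer polynomials and lowers the degree bound. For the other
  roots, \<open>t - a\<close> is prime to \<open>q\<close>, so they are roots of the
  quotient.\<close>

lemma poly_zero_mod_prime:
  fixes P :: "int poly" and q :: int
  assumes "prime q" "degree P \<le> D" "S \<subseteq> {0..<q}" "D < card S" "\<And>t. t \<in> S \<Longrightarrow> q dvd poly P t"
  shows "q dvd poly P t"
  using assms(2-)
proof (induction D arbitrary: P S t)
  case 0
  then obtain s where "s \<in> S" by fastforce
  moreover have "poly P t = poly P s"
    using 0 by (metis degree_eq_zeroE le_zero_eq poly_pCons poly_0 mult_zero_right)
  ultimately show ?case using 0 by simp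
next
  case (Suc D)
  then obtain a where a: "a \<in> S" by fastforce
  define G where "G = synthetic_div P a"
  have P: "P = [:- a, 1:] * G + [:poly P a:]"
    using synthetic_div_correct'[of a P] by (simp add: G_def)
  have val: "poly P t = (t - a) * poly G t + poly P a" for t
    by (subst P) (simp add: algebra_simps)
  have qa: "q dvd poly P a" using Suc a by blast
  have "q dvd poly G t"
  proof (rule Suc.IH[of G "S - {a}"])
    show "degree G \<le> D" using Suc.prems by (simp add: G_def degree_synthetic_div)
    have "finite S" using Suc.prems(2) by (rule finite_subset) simp
    then show "D < card (S - {a})" using a Suc.prems by simp
    fix t assume t: "t \<in> S - {a}"
    then have "q dvd (t - a) * poly G t"
      using val[of t] qa Suc.prems(4)[of t] by (simp add: dvd_add_left_iff)
    moreover have "\<not> q dvd t - a"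
    proof
      assume "q dvd t - a"
      moreover have "t \<in> {0..<q}" "a \<in> {0..<q}" using t a Suc.prems(2) by auto
      ultimately have "t = a" by (intro eq_if_dvd_diff) auto
      then show False using t by simp
    qed
    ultimately show "q dvd poly G t" using \<open>prime q\<close> by (simp add: prime_dvd_mult_iff)
  qed (use Suc.prems in auto)
  then show ?case using val[of t] qa by simp
qed

text \<open>The product of the linear factors of the other nodes is nonzero modulo \<open>q\<close>
  at \<open>i\<close>, because the nodes are distinct residues, and is scaled by the inverse of that
  value.\<close>

lemma exists_lagrange_poly:
  fixes q :: int
  assumes "prime q" "int h \<le> q" "i \<in> {0..<int h}"
  shows "\<exists>L. degree L \<le> h \<and> (\<forall>j\<in>{0..<int h}. [poly L j = (if j = i then 1 else 0)] (mod q))"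
proof -
  define R where "R = (\<Prod>j\<in>{0..<int h} - {i}. [:- j, 1:])"
  have val: "poly R t = (\<Prod>j\<in>{0..<int h} - {i}. t - j)" for t
    by (simp add: R_def poly_prod)
  have "\<not> q dvd poly R i"
  proof
    assume "q dvd poly R i"
    then have "\<exists>j\<in>{0..<int h} - {i}. q dvd i - j"
      using \<open>prime q\<close> by (simp add: val prime_dvd_prod_iff)
    then obtain j where "j \<in> {0..<int h} - {i}" "q dvd i - j" by blast
    then show False using eq_if_dvd_diff[of q i j] assms by auto
  qed
  then have "coprime (poly R i) q"
    using \<open>prime q\<close> by (metis coprime_commute prime_imp_coprime)
  then obtain c where c: "[poly R i * c = 1] (mod q)" using cong_solve_coprime_int by blast
  have "degree R \<le> (\<Sum>j\<in>{0..<int h} - {i}. degree [:- j, 1:])"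
    unfolding R_def using degree_prod_sum_le[of "{0..<int h} - {i}" "\<lambda>j. [:- j, 1:]"] by (simp add: comp_def)
  also have "\<dots> \<le> h" using assms by simp
  finally have deg: "degree (smult c R) \<le> h"
    using degree_smult_le order.trans by blast
  have "[poly (smult c R) j = (if j = i then 1 else 0)] (mod q)" if "j \<in> {0..<int h}" for j
  proof (cases "j = i")
    case True
    then show ?thesis using c by (simp add: mult.commute)
  next
    case False
    then have "poly R j = 0" using that by (auto simp: val)
    then show ?thesis using False by simp
  qed
  with deg show ?thesis by blast
qed

section \<open>The inner binary code\<close>

text \<open>A field symbol \<open>a\<close> is encoded by one bit for each affine map, telling
  whether the image of \<open>a\<close> lies in the lower half of the residues. Distinct symbols
  then differ in about half of the \<open>q ^ 2\<close> bits.\<close>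

definition inner_bit :: "int \<Rightarrow> int \<Rightarrow> int \<Rightarrow> int \<Rightarrow> bool" where
  "inner_bit q a u v \<longleftrightarrow> (u * a + v) mod q < q div 2"

text \<open>For \<open>a\<close> and \<open>b\<close> distinct modulo \<open>q\<close>, the pair \<open>(u a + v, u b + v)\<close> is uniformly distributed.\<close>

lemma card_inner_bit_differs:
  fixes q :: int
  assumes "prime q" "\<not> q dvd a - b"
  shows "card {(u, v). u \<in> {0..<q} \<and> v \<in> {0..<q} \<and> inner_bit q a u v \<noteq> inner_bit q b u v}
       = 2 * nat (q div 2) * nat (q - q div 2)"
proof -
  have q: "q > 1" using \<open>prime q\<close> by (simp add: prime_gt_1_int)
  define F where "F = {0..<q} \<times> {0..<q}"
  define \<phi> where "\<phi> = (\<lambda>(u, v). ((u * a + v) mod q, (u * b + v) mod q))"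
  define B where "B = {0..<q div 2} \<times> {q div 2..<q} \<union> {q div 2..<q} \<times> {0..<q div 2}"
  have inj: "inj_on \<phi> F"
  proof (rule inj_onI, clarsimp simp: F_def \<phi>_def)
    fix u v u' v'
    assume r: "0 \<le> u" "u < q" "0 \<le> v" "v < q" "0 \<le> u'" "u' < q" "0 \<le> v'" "v' < q"
      and e: "(u * a + v) mod q = (u' * a + v') mod q" "(u * b + v) mod q = (u' * b + v') mod q"
    have "q dvd (u * a + v - (u' * a + v')) - (u * b + v - (u' * b + v'))"
      using e by (metis dvd_diff mod_eq_dvd_iff)
    also have "\<dots> = (u - u') * (a - b)" by (simp add: algebra_simps)
    finally have "q dvd u - u'" using assms by (simp add: prime_dvd_mult_iff)
    then have u: "u = u'" using r by (intro eq_if_dvd_diff)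
    with e(1) have "q dvd v - v'" by (simp add: mod_eq_dvd_iff)
    then show "u = u' \<and> v = v'" using r u by (auto intro: eq_if_dvd_diff)
  qed
  have "\<phi> ` F \<subseteq> F" using q by (auto simp: F_def \<phi>_def)
  \<comment> \<open>An injective self-map of the finite set \<open>F\<close> is a bijection, so the
    preimage of the set \<open>B\<close> of separated pairs has exactly \<open>card B\<close>
    elements.\<close>
  then have onto: "\<phi> ` F = F"
    using inj by (intro endo_inj_surj) (auto simp: F_def)
  have BF: "B \<subseteq> F" using q by (auto simp: B_def F_def)
  have eq: "{(u, v). u \<in> {0..<q} \<and> v \<in> {0..<q} \<and> inner_bit q a u v \<noteq> inner_bit q b u v} = {p \<in> F. \<phi> p \<in> B}"
    using q by (auto simp: F_def \<phi>_def B_def inner_bit_def)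
  have image: "\<phi> ` {p \<in> F. \<phi> p \<in> B} = B"
  proof
    show "B \<subseteq> \<phi> ` {p \<in> F. \<phi> p \<in> B}"
    proof
      fix b assume b: "b \<in> B"
      then have "b \<in> \<phi> ` F" using onto BF by blast
      with b show "b \<in> \<phi> ` {p \<in> F. \<phi> p \<in> B}" by blast
    qed
  qed auto
  have "card {p \<in> F. \<phi> p \<in> B} = card B"
    by (subst image[symmetric], rule card_image[symmetric]) (rule inj_on_subset[OF inj], auto)
  also have "card B = card ({0..<q div 2} \<times> {q div 2..<q}) + card ({q div 2..<q} \<times> {0..<q div 2})"
    unfolding B_def by (rule card_Un_disjoint) fastforce+
  also have "\<dots> = 2 * nat (q div 2) * nat (q - q div 2)"
    by (simp add: card_cartesian_product)
  finally show ?thesis unfolding eq .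
qed

section \<open>Reed-Muller codes\<close>

text \<open>The low-degree extension of the message: bit \<open>i\<close> sits at the grid point
  \<open>\<iota> i\<close>, and the polynomials \<open>L j\<close> serve as a Lagrange basis on
  \<open>{0..<h}\<close> in each coordinate.\<close>

definition rm_eval :: "nat \<Rightarrow> ('i \<Rightarrow> nat \<Rightarrow> int) \<Rightarrow> (int \<Rightarrow> int poly) \<Rightarrow> 'i set \<Rightarrow> ('i \<Rightarrow> bool) \<Rightarrow> (nat \<Rightarrow> int) \<Rightarrow> int" where
  "rm_eval m \<iota> L I x z = (\<Sum>i\<in>{i \<in> I. x i}. \<Prod>k<m. poly (L (\<iota> i k)) (z k))"

lemma rm_eval_cong_mod:
  fixes q :: int
  assumes "\<And>k. k < m \<Longrightarrow> [z k = z' k] (mod q)"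
  shows "[rm_eval m \<iota> L I x z = rm_eval m \<iota> L I x z'] (mod q)"
  unfolding rm_eval_def
  by (intro cong_sum cong_prod) (use assms in \<open>auto simp: poly_altdef intro!: cong_sum cong_mult cong_pow\<close>)

lemma rm_eval_line:
  assumes "finite I" and deg: "\<And>i. degree (L i) \<le> h"
  shows "\<exists>P. degree P \<le> m * h \<and> (\<forall>t. rm_eval m \<iota> L I x (\<lambda>k. z k + t * y k) = poly P t)"
proof (intro exI conjI allI)
  let ?P = "\<Sum>i\<in>{i \<in> I. x i}. \<Prod>k<m. pcompose (L (\<iota> i k)) [:z k, y k:]"
  show "rm_eval m \<iota> L I x (\<lambda>k. z k + t * y k) = poly ?P t" for t
    by (simp add: rm_eval_def poly_sum poly_prod poly_pcompose)
  have "degree (\<Prod>k<m. pcompose (L (\<iota> i k)) [:z k, y k:]) \<le> m * h" for i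
  proof -
    have "degree (pcompose (L (\<iota> i k)) [:z k, y k:]) \<le> h" for k
    proof -
      have "degree (pcompose (L (\<iota> i k)) [:z k, y k:]) \<le> degree (L (\<iota> i k)) * degree [:z k, y k:]"
        by (rule degree_pcompose_le)
      also have "\<dots> \<le> degree (L (\<iota> i k)) * 1" by (rule mult_le_mono2) simp
      finally show ?thesis using deg[of "\<iota> i k"] by simp
    qed
    then have "(\<Sum>k<m. degree (pcompose (L (\<iota> i k)) [:z k, y k:])) \<le> (\<Sum>k<m. h)"
      by (intro sum_mono)
    then show ?thesis using degree_prod_sum_le[of "{..<m}" "\<lambda>k. pcompose (L (\<iota> i k)) [:z k, y k:]"]
      by (simp add: comp_def)
  qed
  then show "degree ?P \<le> m * h" using assms by (intro degree_sum_le) auto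
qed

text \<open>Distinct grid points differ in some coordinate, where the Lagrange factor vanishes
  modulo \<open>q\<close>; only the summand of \<open>i\<close> itself survives.\<close>

lemma rm_eval_message:
  fixes q :: int
  assumes I: "finite I" "i \<in> I"
    and \<iota>: "\<And>i k. i \<in> I \<Longrightarrow> k < m \<Longrightarrow> \<iota> i k \<in> {0..<int h}"
    and inj: "\<And>i i'. i \<in> I \<Longrightarrow> i' \<in> I \<Longrightarrow> i \<noteq> i' \<Longrightarrow> \<exists>k<m. \<iota> i k \<noteq> \<iota> i' k"
    and L: "\<And>i j. i \<in> {0..<int h} \<Longrightarrow> j \<in> {0..<int h} \<Longrightarrow> [poly (L i) j = (if j = i then 1 else 0)] (mod q)"
  shows "[rm_eval m \<iota> L I x (\<iota> i) = (if x i then 1 else 0)] (mod q)"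
proof -
  have "[(\<Prod>k<m. poly (L (\<iota> i' k)) (\<iota> i k)) = (if i' = i then 1 else 0)] (mod q)" if "i' \<in> I" for i'
  proof -
    have "[(\<Prod>k<m. poly (L (\<iota> i' k)) (\<iota> i k)) = (\<Prod>k<m. if \<iota> i k = \<iota> i' k then 1 else 0)] (mod q)"
      using that I \<iota> by (intro cong_prod L) auto
    moreover have "(\<Prod>k<m. if \<iota> i k = \<iota> i' k then 1 else (0::int)) = (if i' = i then 1 else 0)"
      using inj[OF I(2) that] by (auto intro!: prod_zero)
    ultimately show ?thesis by simp
  qed
  then have "[rm_eval m \<iota> L I x (\<iota> i) = (\<Sum>i'\<in>{i \<in> I. x i}. if i' = i then 1 else 0)] (mod q)"
    unfolding rm_eval_def by (intro cong_sum) auto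
  then show ?thesis using I by (simp add: if_distrib cong: if_cong)
qed

text \<open>Two extensions that differ at a grid point agree at no more than \<open>m * h\<close>
  parameters of a line through it, fewer than \<open>q / 8\<close>. At the others the inner code
  separates the symbols in about half of the bits, leaving at least a quarter overall.\<close>

theorem smooth_code_exists:
  fixes I :: "'i set" and q m h :: nat
  assumes I: "finite I" "card I \<le> h ^ m" and q: "prime q" and h: "0 < h" "0 < m" "8 * (m * h) < q"
  shows "\<exists>(J :: ((nat \<Rightarrow> int) \<times> int \<times> int) set) (L :: (int \<times> int \<times> int) set) (Y :: (nat \<Rightarrow> int) set) enc pos.
    smooth_code I J L Y enc pos \<and> card J = q ^ (m + 2) \<and> card L \<le> q ^ 3"
proof -
  define F where "F = {0..<int q}"
  define V where "V = (\<Pi>\<^sub>E k\<in>{..<m}. F)"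
  \<comment> \<open>The parameter \<open>t = 0\<close> is excluded: every line passes through the
    message point there, which would destroy uniformity.\<close>
  define Lb where "Lb = {1..<int q} \<times> F \<times> F"
  define J where "J = V \<times> F \<times> F"
  have q1: "q > 1" using q by (rule prime_gt_1_nat)
  have pq: "prime (int q)" using q by simp
  have hq: "int h \<le> int q"
  proof -
    have "h \<le> m * h" using h by simp
    then show ?thesis using h(3) by linarith
  qed
  have cardF: "card F = q" "finite F" by (auto simp: F_def)
  have cardV: "card V = q ^ m" "finite V" by (auto simp: V_def card_PiE cardF intro!: finite_PiE)
  have cardL: "card Lb = (q - 1) * q * q" "finite Lb"
    by (auto simp: Lb_def card_cartesian_product cardF)
  have cardJ: "card J = q ^ m * q * q" "finite J"
    by (auto simp: J_def card_cartesian_product cardF cardV)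

  have "card (\<Pi>\<^sub>E k\<in>{..<m}. {0..<int h}) = h ^ m" by (simp add: card_PiE)
  then obtain \<iota> where \<iota>: "inj_on \<iota> I" "\<iota> ` I \<subseteq> (\<Pi>\<^sub>E k\<in>{..<m}. {0..<int h})"
    using card_le_inj[of I "\<Pi>\<^sub>E k\<in>{..<m}. {0..<int h}"] I by (auto intro: finite_PiE)
  have \<iota>_range: "\<iota> i k \<in> {0..<int h}" if "i \<in> I" "k < m" for i k
    using \<iota>(2) that by (auto simp: image_subset_iff PiE_def Pi_def)
  have \<iota>_inj: "\<exists>k<m. \<iota> i k \<noteq> \<iota> i' k" if "i \<in> I" "i' \<in> I" "i \<noteq> i'" for i i'
  proof (rule ccontr)
    assume "\<not> ?thesis"
    then have "\<iota> i = \<iota> i'" using \<iota>(2) that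
      by (intro PiE_ext[of _ "{..<m}" "\<lambda>_. {0..<int h}"]) auto
    then show False using \<iota>(1) that by (auto dest: inj_onD)
  qed

  have "\<forall>i. \<exists>P. degree P \<le> h \<and> (i \<in> {0..<int h} \<longrightarrow> (\<forall>j\<in>{0..<int h}. [poly P j = (if j = i then 1 else 0)] (mod int q)))"
  proof
    fix i
    show "\<exists>P. degree P \<le> h \<and> (i \<in> {0..<int h} \<longrightarrow> (\<forall>j\<in>{0..<int h}. [poly P j = (if j = i then 1 else 0)] (mod int q)))"
    proof (cases "i \<in> {0..<int h}")
      case True
      then show ?thesis using exists_lagrange_poly[OF pq hq True] by blast
    next
      case False
      then show ?thesis by (intro exI[of _ 0]) auto
    qed
  qed
  from choice[OF this] obtain Lg where Lg: "\<And>i. degree (Lg i) \<le> h"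
      "\<And>i j. i \<in> {0..<int h} \<Longrightarrow> j \<in> {0..<int h} \<Longrightarrow> [poly (Lg i) j = (if j = i then 1 else 0)] (mod int q)"
    by blast
  define ev where "ev = rm_eval m \<iota> Lg I"
  define pt where "pt = (\<lambda>i (y :: nat \<Rightarrow> int) (t :: int). \<lambda>k\<in>{..<m}. (\<iota> i k + t * y k) mod int q)"
  define enc where "enc = (\<lambda>x (z, u, v). inner_bit (int q) (ev x z) u v)"
  define pos where "pos = (\<lambda>i y (t :: int, u :: int, v :: int). (pt i y t, u, v))"

  have pt_in: "pt i y t \<in> V" for i y t
    unfolding V_def pt_def F_def using q1 by (intro PiE_I) simp_all
  have pos_in: "pos i y l \<in> J" if "l \<in> Lb" for i y l
    using that pt_in by (cases l) (simp add: pos_def J_def Lb_def)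

  have differ: "card Lb \<le> 4 * card {l \<in> Lb. enc x (pos i y l) \<noteq> enc x' (pos i y l)}"
    if i: "i \<in> I" and xi: "x i \<noteq> x' i" for i y x x'
  proof -
    have ev_pt: "\<exists>P. degree P \<le> m * h \<and> (\<forall>t. [ev x (pt i y t) = poly P t] (mod int q)) \<and>
                   [poly P 0 = (if x i then 1 else 0)] (mod int q)" for x
    proof -
      obtain P where P: "degree P \<le> m * h" "\<And>t. ev x (\<lambda>k. \<iota> i k + t * y k) = poly P t"
        unfolding ev_def
        using rm_eval_line[where L = Lg and m = m and \<iota> = \<iota> and x = x and z = "\<iota> i" and y = y,
            OF I(1) Lg(1)] by blast
      have "[ev x (pt i y t) = poly P t] (mod int q)" for t
        unfolding P(2)[symmetric] ev_def
        by (rule rm_eval_cong_mod) (simp add: pt_def cong_def)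
      moreover have "[ev x (\<iota> i) = (if x i then 1 else 0)] (mod int q)"
        unfolding ev_def by (rule rm_eval_message[OF I(1) i \<iota>_range \<iota>_inj Lg(2)])
      moreover have "poly P 0 = ev x (\<iota> i)" by (simp flip: P(2))
      ultimately show ?thesis using P(1) by auto
    qed
    obtain P P' where P: "degree P \<le> m * h" "\<And>t. [ev x (pt i y t) = poly P t] (mod int q)"
        "[poly P 0 = (if x i then 1 else 0)] (mod int q)"
      and P': "degree P' \<le> m * h" "\<And>t. [ev x' (pt i y t) = poly P' t] (mod int q)"
        "[poly P' 0 = (if x' i then 1 else 0)] (mod int q)"
      using ev_pt[of x] ev_pt[of x'] by blast
    \<comment> \<open>At \<open>t = 0\<close> the two restrictions are the two message bits modulo
      \<open>q\<close>, so their difference is not the zero polynomial modulo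
      \<open>q\<close>.\<close>
    have nz: "\<not> int q dvd poly (P - P') 0"
    proof
      assume "int q dvd poly (P - P') 0"
      then have "[poly P 0 = poly P' 0] (mod int q)" by (simp add: cong_iff_dvd_diff)
      then have "[(if x i then 1 else 0) = (if x' i then 1 else (0::int))] (mod int q)"
        using P(3) P'(3) by (meson cong_sym cong_trans)
      then show False using xi q1 by (auto simp: cong_def split: if_splits)
    qed
    define Z where "Z = {t \<in> {1..<int q}. int q dvd poly (P - P') t}"
    have "card Z \<le> m * h"
    proof (rule ccontr)
      assume "\<not> card Z \<le> m * h"
      then have "m * h < card Z" by simp
      moreover have "degree (P - P') \<le> m * h" using P(1) P'(1) by (rule degree_diff_le)
      moreover have "Z \<subseteq> {0..<int q}" by (auto simp: Z_def)
      moreover have "\<And>t. t \<in> Z \<Longrightarrow> int q dvd poly (P - P') t" by (simp add: Z_def)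
      ultimately have "int q dvd poly (P - P') 0" using poly_zero_mod_prime[OF pq] by metis
      then show False using nz by simp
    qed
    define W where "W = {1..<int q} - Z"
    have "Z \<subseteq> {1..<int q}" by (auto simp: Z_def)
    then have "card W = (q - 1) - card Z"
      by (simp add: W_def card_Diff_subset finite_subset[of Z "{1..<int q}"])
    then have cardW: "q - 1 \<le> m * h + card W" "finite W"
      using \<open>card Z \<le> m * h\<close> by (auto simp: W_def)
    define X where "X = (\<lambda>t. {(u, v). u \<in> F \<and> v \<in> F \<and>
       inner_bit (int q) (ev x (pt i y t)) u v \<noteq> inner_bit (int q) (ev x' (pt i y t)) u v})"
    have cardX: "card (X t) = 2 * (q div 2) * (q - q div 2)" if "t \<in> W" for t
    proof -
      have "\<not> int q dvd poly P t - poly P' t" using that by (auto simp: W_def Z_def)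
      then have "\<not> [ev x (pt i y t) = ev x' (pt i y t)] (mod int q)"
        using P(2)[of t] P'(2)[of t] by (meson cong_iff_dvd_diff cong_sym cong_trans)
      then have "\<not> int q dvd ev x (pt i y t) - ev x' (pt i y t)" by (simp add: cong_iff_dvd_diff)
      from card_inner_bit_differs[OF pq this] show ?thesis
        by (simp add: X_def F_def nat_diff_distrib' nat_div_distrib)
    qed
    have finX: "finite (X t)" for t
      by (rule finite_subset[of _ "F \<times> F"]) (auto simp: X_def cardF)
    have "card (SIGMA t:W. X t) = card W * (2 * (q div 2) * (q - q div 2))"
      using cardX cardW finX by (simp add: card_SigmaI)
    moreover have "(SIGMA t:W. X t) \<subseteq> {l \<in> Lb. enc x (pos i y l) \<noteq> enc x' (pos i y l)}"
      by (auto simp: W_def X_def Lb_def enc_def pos_def)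
    then have "card (SIGMA t:W. X t) \<le> card {l \<in> Lb. enc x (pos i y l) \<noteq> enc x' (pos i y l)}"
      using cardL(2) by (intro card_mono) auto
    ultimately have le: "card W * (2 * (q div 2) * (q - q div 2)) \<le> card {l \<in> Lb. enc x (pos i y l) \<noteq> enc x' (pos i y l)}"
      by simp
    \<comment> \<open>The bound \<open>8 * (m * h) < q\<close> rules out 2. Oddness gives the exact
      value \<open>2 * p * (p + 1)\<close> for the number of separating inner bits.\<close>
    have "odd q" using q h prime_odd_nat[of q] by (cases "q = 2") (auto simp: prime_ge_2_nat)
    then obtain p where p: "q = 2 * p + 1" by (rule oddE)
    have "(q - 1) * q * q \<le> 4 * (card W * (2 * (q div 2) * (q - q div 2)))"
    proof -
      have w: "14 * p \<le> 8 * card W" using cardW(1) h(3) p by simp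
      have "(q - 1) * q * q = 2 * p * (4 * p * p + 4 * p + 1)" by (simp add: p algebra_simps)
      also have "\<dots> \<le> 2 * p * (7 * p * (p + 1))"
        using q1 p by (intro mult_le_mono2) (cases p; simp add: algebra_simps)
      also have "\<dots> = 14 * p * (p * (p + 1))" by simp
      also have "\<dots> \<le> 8 * card W * (p * (p + 1))" by (rule mult_le_mono1[OF w])
      also have "\<dots> = 4 * (card W * (2 * (q div 2) * (q - q div 2)))" by (simp add: p algebra_simps)
      finally show ?thesis .
    qed
    then show ?thesis using le by (simp add: cardL)
  qed

  have smooth: "card J * card {(y, l). y \<in> V \<and> l \<in> Lb \<and> pos i y l = j} \<le> card V * card Lb"
    if "i \<in> I" "j \<in> J" for i j
  proof -
    define X where "X = {(y, l). y \<in> V \<and> l \<in> Lb \<and> pos i y l = j}"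
    \<comment> \<open>For \<open>t \<noteq> 0\<close> the direction can be solved for from the point
      reached, so each position is hit at most once per \<open>t\<close>.\<close>
    have inj: "inj_on (\<lambda>(y, t, u, v). t) X"
    proof (rule inj_onI, clarsimp simp: X_def)
      fix y y' t u v u' v'
      assume y: "y \<in> V" "y' \<in> V" and t: "(t, u, v) \<in> Lb"
        and e: "pos i y' (t, u', v') = pos i y (t, u, v)"
      have pt: "pt i y t = pt i y' t" and uv: "u = u'" "v = v'" using e by (auto simp: pos_def)
      have "y k = y' k" if "k \<in> {..<m}" for k
      proof -
        have "(\<iota> i k + t * y k) mod int q = (\<iota> i k + t * y' k) mod int q"
          using fun_cong[OF pt, of k] that by (simp add: pt_def)
        then have "int q dvd t * (y k - y' k)" by (simp add: mod_eq_dvd_iff algebra_simps)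
        moreover have "\<not> int q dvd t" using t by (auto simp: Lb_def dest: zdvd_imp_le)
        ultimately have "int q dvd y k - y' k" using pq by (simp add: prime_dvd_mult_iff)
        then show ?thesis using y that by (intro eq_if_dvd_diff) (auto simp: V_def F_def PiE_def Pi_def)
      qed
      then have "y = y'" using y unfolding V_def by (intro PiE_ext) auto
      with uv show "y = y' \<and> u = u' \<and> v = v'" by simp
    qed
    have "(\<lambda>(y, t, u, v). t) ` X \<subseteq> {1..<int q}" by (auto simp: X_def Lb_def)
    then have "card X \<le> card {1..<int q}" by (intro card_inj_on_le[OF inj]) auto
    then have "card J * card X \<le> card J * (q - 1)" by (intro mult_le_mono2) simp
    then show ?thesis by (simp add: X_def cardJ cardV cardL mult_ac)
  qed

  have ne: "V \<noteq> {}" "J \<noteq> {}" "Lb \<noteq> {}"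
    using q1 cardV cardJ cardL by fastforce+
  have "smooth_code I J Lb V enc pos"
    unfolding smooth_code_def
    by (intro conjI ballI allI impI) (rule ne cardJ(2) cardL(2) cardV(2) pos_in differ smooth; assumption)+
  moreover have "card J = q ^ (m + 2)" by (simp add: cardJ power_add power2_eq_square)
  moreover have "card Lb \<le> q ^ 3" by (simp add: cardL power3_eq_cube)
  ultimately show ?thesis by (intro exI conjI)
qed

section \<open>Data structures from smooth codes\<close>

text \<open>A nonadaptive tree: the answers are collected in \<open>acc\<close>, whose initial
  values remain as defaults at unread positions.\<close>

primrec read_tree :: "nat list \<Rightarrow> (nat \<Rightarrow> bool) \<Rightarrow> ((nat \<Rightarrow> bool) \<Rightarrow> 'a option) \<Rightarrow> 'a decision_tree" where
  "read_tree [] acc g = Output (g acc)"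
| "read_tree (i # is) acc g = Probe i (read_tree is (acc(i := False)) g) (read_tree is (acc(i := True)) g)"

lemma dt_run_read_tree:
  "dt_run w (read_tree is acc g) = g (\<lambda>i. if i \<in> set is then w ! i else acc i)"
  by (induction "is" arbitrary: acc) (auto intro!: arg_cong[of _ _ g])

lemma dt_num_probes_read_tree: "dt_num_probes w (read_tree is acc g) = length is"
  by (induction "is" arbitrary: acc) auto

lemma dt_valid_read_tree:
  "set is \<subseteq> {..<N} \<Longrightarrow> (\<And>v. set_option (g v) \<subseteq> A) \<Longrightarrow> dt_valid N A (read_tree is acc g)"
  by (induction "is" arbitrary: acc) auto

abbreviation lists_of_length :: "'y set \<Rightarrow> nat \<Rightarrow> 'y list set" where
  "lists_of_length Y r \<equiv> {ys. set ys \<subseteq> Y \<and> length ys = r}"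

text \<open>The moment generating function of the number of bad lines, for a Chernoff bound.\<close>

lemma sum_lists_power:
  fixes c :: nat
  assumes "finite Y"
  shows "(\<Sum>ys\<in>lists_of_length Y r. c ^ length (filter P ys)) = (\<Sum>y\<in>Y. if P y then c else 1) ^ r"
proof (induction r)
  case 0
  have "lists_of_length Y 0 = {[]}" by auto
  then show ?case by simp
next
  case (Suc r)
  have "(\<Sum>ys\<in>lists_of_length Y (Suc r). c ^ length (filter P ys))
      = (\<Sum>(ys, y)\<in>lists_of_length Y r \<times> Y. c ^ length (filter P (y # ys)))"
    unfolding lists_length_Suc_eq
    by (subst sum.reindex) (auto simp: inj_on_def intro!: sum.cong)
  also have "\<dots> = (\<Sum>ys\<in>lists_of_length Y r. \<Sum>y\<in>Y. (if P y then c else 1) * c ^ length (filter P ys))"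
    by (subst sum.cartesian_product[symmetric]) (auto intro!: sum.cong)
  also have "\<dots> = (\<Sum>y\<in>Y. if P y then c else 1) ^ Suc r"
    by (subst sum.swap) (simp add: Suc.IH[symmetric] sum_product)
  finally show ?case .
qed

text \<open>Weight each list by 16 to the number of its bad entries. Lists with at least half bad
  entries have weight at least \<open>4 ^ r\<close>, while the average weight per entry is at most
  \<open>1 + 16 / 16 = 2\<close>, so their proportion is at most
  \<open>2 ^ r / 4 ^ r\<close>.\<close>

lemma card_majority_bad:
  assumes Y: "finite Y" and bad: "16 * card {y \<in> Y. P y} \<le> card Y"
  shows "card {ys \<in> lists_of_length Y r. r \<le> 2 * length (filter P ys)} * 2 ^ r \<le> card Y ^ r"
proof -
  let ?M = "{ys \<in> lists_of_length Y r. r \<le> 2 * length (filter P ys)}"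
  have fin: "finite (lists_of_length Y r)" by (rule finite_lists_length_eq[OF Y])
  have "card ?M * 4 ^ r = (\<Sum>ys\<in>?M. 4 ^ r)" by simp
  also have "\<dots> \<le> (\<Sum>ys\<in>?M. 16 ^ length (filter P ys))"
  proof (rule sum_mono)
    fix ys assume "ys \<in> ?M"
    then have "(4::nat) ^ r \<le> 4 ^ (2 * length (filter P ys))" by (intro power_increasing) auto
    also have "\<dots> = 16 ^ length (filter P ys)" by (simp add: power_mult)
    finally show "(4::nat) ^ r \<le> 16 ^ length (filter P ys)" .
  qed
  also have "\<dots> \<le> (\<Sum>ys\<in>lists_of_length Y r. 16 ^ length (filter P ys))"
    using fin by (intro sum_mono2) auto
  also have "\<dots> = (\<Sum>y\<in>Y. if P y then 16 else 1) ^ r" by (rule sum_lists_power[OF Y])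
  also have "\<dots> \<le> (2 * card Y) ^ r"
  proof (rule power_mono)
    have "(\<Sum>y\<in>Y. if P y then 16 else 1 :: nat) \<le> (\<Sum>y\<in>Y. 1 + (if P y then 16 else 0))"
      by (rule sum_mono) simp
    also have "\<dots> = (\<Sum>y\<in>Y. 1) + (\<Sum>y\<in>Y. if P y then 16 else 0)" by (rule sum.distrib)
    also have "\<dots> = card Y + 16 * card {y \<in> Y. P y}"
      using Y by (simp flip: sum.inter_filter)
    finally show "(\<Sum>y\<in>Y. if P y then 16 else 1) \<le> 2 * card Y" using bad by simp
  qed simp
  finally have "card ?M * 4 ^ r \<le> (2 * card Y) ^ r" .
  moreover have "(4::nat) ^ r = 2 ^ r * 2 ^ r" by (simp flip: power_mult_distrib)
  ultimately have "(card ?M * 2 ^ r) * 2 ^ r \<le> card Y ^ r * 2 ^ r"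
    by (simp only: power_mult_distrib mult_ac)
  then show ?thesis by (simp only: mult_le_cancel2) simp
qed

section \<open>Decoding by a majority of lines\<close>

text \<open>The threshold \<open>1 / 8\<close> is half of the relative distance \<open>1 / 4\<close>
  that a smooth code guarantees on a line.\<close>

definition bad_line :: "'l set \<Rightarrow> ('i \<Rightarrow> 'y \<Rightarrow> 'l \<Rightarrow> 'j) \<Rightarrow> ('j \<Rightarrow> bool) \<Rightarrow> ('j \<Rightarrow> bool) \<Rightarrow> 'i \<Rightarrow> 'y \<Rightarrow> bool" where
  "bad_line L pos v c i y \<longleftrightarrow> card L \<le> 8 * card {l \<in> L. v (pos i y l) \<noteq> c (pos i y l)}"

text \<open>Markov's inequality by double counting: by smoothness the average proportion of errors
  on a line is at most \<open>1 / 128\<close>, so at most \<open>1 / 16\<close> of the lines carry a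
  proportion of \<open>1 / 8\<close> or more.\<close>

lemma few_bad_lines:
  assumes code: "smooth_code I J L Y enc pos" and i: "i \<in> I"
    and few: "128 * card {j \<in> J. v j \<noteq> c j} \<le> card J"
  shows "16 * card {y \<in> Y. bad_line L pos v c i y} \<le> card Y"
proof -
  define E where "E = {j \<in> J. v j \<noteq> c j}"
  define B where "B = {y \<in> Y. bad_line L pos v c i y}"
  define X where "X = (\<lambda>j. {(y, l). y \<in> Y \<and> l \<in> L \<and> pos i y l = j})"
  have fin: "finite J" "finite L" "finite Y" "J \<noteq> {}" "L \<noteq> {}"
    and pos: "\<And>y l. y \<in> Y \<Longrightarrow> l \<in> L \<Longrightarrow> pos i y l \<in> J"
    and smooth: "\<And>j. j \<in> J \<Longrightarrow> card J * card (X j) \<le> card Y * card L"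
    using code i by (auto simp: smooth_code_def X_def)
  have finX: "finite (X j)" for j
    by (rule finite_subset[of _ "Y \<times> L"]) (use fin in \<open>auto simp: X_def\<close>)
  have cJ: "card J > 0" and cL: "card L > 0" using fin by (auto simp: card_gt_0_iff)
  have "card B * card L = (\<Sum>y\<in>B. card L)" by simp
  also have "\<dots> \<le> (\<Sum>y\<in>B. 8 * card {l \<in> L. v (pos i y l) \<noteq> c (pos i y l)})"
    by (rule sum_mono) (simp add: B_def bad_line_def)
  also have "\<dots> = 8 * card (SIGMA y:B. {l \<in> L. v (pos i y l) \<noteq> c (pos i y l)})"
    using fin by (subst card_SigmaI) (auto simp: B_def sum_distrib_left)
  also have "\<dots> \<le> 8 * card (\<Union>j\<in>E. X j)"
    using fin pos finX by (intro mult_le_mono2 card_mono) (auto simp: E_def X_def B_def)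
  also have "\<dots> \<le> 8 * (\<Sum>j\<in>E. card (X j))"
    using fin by (intro mult_le_mono2 card_UN_le) (simp add: E_def)
  finally have "card J * (card B * card L) \<le> card J * (8 * (\<Sum>j\<in>E. card (X j)))"
    by (rule mult_le_mono2)
  also have "\<dots> = 8 * (\<Sum>j\<in>E. card J * card (X j))" by (simp add: sum_distrib_left mult_ac)
  also have "\<dots> \<le> 8 * (\<Sum>j\<in>E. card Y * card L)"
    by (intro mult_le_mono2 sum_mono smooth) (simp add: E_def)
  also have "\<dots> = 8 * card E * (card Y * card L)" by simp
  finally have "16 * (card J * (card B * card L)) \<le> 128 * card E * (card Y * card L)" by linarith
  also have "\<dots> \<le> card J * (card Y * card L)"
    by (rule mult_le_mono1) (use few in \<open>simp add: E_def\<close>)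
  finally have "(card J * card L) * (16 * card B) \<le> (card J * card L) * card Y" by (simp add: mult_ac)
  then show ?thesis using cJ cL by (simp add: B_def)
qed

text \<open>Two strict majorities share a line. There both code words differ from \<open>v\<close>
  in less than \<open>1 / 8\<close> of the positions, hence from each other in less than
  \<open>1 / 4\<close>, which is impossible if the bits differ.\<close>

lemma majority_decodes:
  assumes code: "smooth_code I J L Y enc pos" and i: "i \<in> I" and ys: "set ys \<subseteq> Y"
    and b: "2 * length (filter (bad_line L pos v (enc x) i) ys) < length ys"
    and b': "2 * length (filter (bad_line L pos v (enc x') i) ys) < length ys"
  shows "x i = x' i"
proof (rule ccontr)
  assume ne: "x i \<noteq> x' i"
  have "\<exists>y\<in>set ys. \<not> bad_line L pos v (enc x) i y \<and> \<not> bad_line L pos v (enc x') i y"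
  proof (rule ccontr)
    assume "\<not> ?thesis"
    then have "filter (\<lambda>y. \<not> bad_line L pos v (enc x) i y) ys
        = filter (\<lambda>y. \<not> bad_line L pos v (enc x) i y \<and> bad_line L pos v (enc x') i y) ys"
      by (intro filter_cong) auto
    also have "length \<dots> \<le> length (filter (bad_line L pos v (enc x') i) ys)"
      by (induction ys) auto
    finally show False
      using b b' sum_length_filter_compl[of "bad_line L pos v (enc x) i" ys] by simp
  qed
  then obtain y where y: "y \<in> Y" "\<not> bad_line L pos v (enc x) i y" "\<not> bad_line L pos v (enc x') i y"
    using ys by auto
  have L: "finite L" using code by (simp add: smooth_code_def)
  have "card L \<le> 4 * card {l \<in> L. enc x (pos i y l) \<noteq> enc x' (pos i y l)}"
    using code i y(1) ne by (simp add: smooth_code_def)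
  also have "card {l \<in> L. enc x (pos i y l) \<noteq> enc x' (pos i y l)}
      \<le> card ({l \<in> L. v (pos i y l) \<noteq> enc x (pos i y l)} \<union> {l \<in> L. v (pos i y l) \<noteq> enc x' (pos i y l)})"
    using L by (intro card_mono) auto
  also have "\<dots> \<le> card {l \<in> L. v (pos i y l) \<noteq> enc x (pos i y l)} + card {l \<in> L. v (pos i y l) \<noteq> enc x' (pos i y l)}"
    by (rule card_Un_le)
  finally show False using y(2,3) by (simp add: bad_line_def)
qed


text \<open>The same \<open>r\<close> random directions serve all bits of a query. Each bit fails
  with probability at most \<open>2 ^ -r\<close>, and the union bound over at most \<open>T\<close>
  bits gives \<open>\<epsilon>\<close>.\<close>

theorem has_data_structure_of_smooth_code:
  fixes enc0 :: "'d \<Rightarrow> 'i \<Rightarrow> bool" and f :: "'d \<Rightarrow> 'q \<Rightarrow> 'a"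
  assumes code: "smooth_code I J L Y enc pos"
    and probes: "\<And>q. q \<in> Q \<Longrightarrow> finite (probes q) \<and> probes q \<subseteq> I \<and> card (probes q) \<le> T"
    and determined: "\<And>x x' q. x \<in> D \<Longrightarrow> x' \<in> D \<Longrightarrow> q \<in> Q \<Longrightarrow>
       (\<And>i. i \<in> probes q \<Longrightarrow> enc0 x i = enc0 x' i) \<Longrightarrow> f x q = f x' q"
    and range: "\<And>x q. x \<in> D \<Longrightarrow> q \<in> Q \<Longrightarrow> f x q \<in> A"
    and \<epsilon>: "real T \<le> \<epsilon> * 2 ^ r" and \<delta>: "\<delta> \<le> 1 / 128" and lam: "0 \<le> lam"
    and t: "T * r * card L \<le> t"
  shows "has_data_structure D Q A f t \<delta> \<epsilon> lam (card J)"
proof -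
  have fin: "finite J" "finite L" "finite Y" "Y \<noteq> {}"
    and pos: "\<And>i y l. i \<in> I \<Longrightarrow> y \<in> Y \<Longrightarrow> l \<in> L \<Longrightarrow> pos i y l \<in> J"
    using code by (auto simp: smooth_code_def)
  define N where "N = card J"
  obtain b where b: "bij_betw b {..<N} J"
    using ex_bij_betw_nat_finite[OF fin(1)] by (auto simp: N_def atLeast0LessThan)
  define b' where "b' = inv_into {..<N} b"
  have b': "b' j < N" "b (b' j) = j" if "j \<in> J" for j
    using that b unfolding b'_def by (auto simp: bij_betw_def inv_into_into f_inv_into_f dest: inv_into_into[of j b "{..<N}"])
  have b'b: "b' (b k) = k" if "k < N" for k
    using that b unfolding b'_def by (auto simp: bij_betw_def)

  define Enc where "Enc = (\<lambda>x. map (\<lambda>k. enc (enc0 x) (b k)) [0..<N])"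
  define good where "good = (\<lambda>v x i ys. 2 * length (filter (bad_line L pos v (enc (enc0 x)) i) ys) < r)"
  \<comment> \<open>A candidate data item passes if, for every probed bit, most of the drawn lines
    are close to its code word. Any passing candidate may supply the answer; without one the answer
    is \<open>None\<close>.\<close>
  define ok where "ok = (\<lambda>q ys v x. x \<in> D \<and> (\<forall>i\<in>probes q. good v x i ys))"
  define ans where "ans = (\<lambda>q ys v. if \<exists>x. ok q ys v x then Some (f (SOME x. ok q ys v x) q) else None)"
  define R where "R = (\<lambda>q ys. (\<lambda>(i, y, l). b' (pos i y l)) ` (probes q \<times> set ys \<times> L))"
  define tree where "tree = (\<lambda>q ys. read_tree (sorted_list_of_set (R q ys)) (\<lambda>_. False) (\<lambda>v. ans q ys (v \<circ> b')))"
  define Ys where "Ys = lists_of_length Y r"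
  define Dec where "Dec = (\<lambda>q. map_pmf (tree q) (pmf_of_set Ys))"

  have Ys: "finite Ys" "Ys \<noteq> {}" "card Ys = card Y ^ r"
  proof -
    show "finite Ys" unfolding Ys_def by (rule finite_lists_length_eq) (rule fin)
    show card: "card Ys = card Y ^ r" unfolding Ys_def by (rule card_lists_length_eq) (rule fin)
    show "Ys \<noteq> {}" using card fin by (metis card.empty card_eq_0_iff power_not_zero)
  qed

  \<comment> \<open>The answer depends on the oracle only along the drawn lines, so the tree may
    fill the unread positions arbitrarily.\<close>
  have ans_cong: "ans q ys v = ans q ys v'"
    if same: "\<And>i y l. i \<in> probes q \<Longrightarrow> y \<in> set ys \<Longrightarrow> l \<in> L \<Longrightarrow> v (pos i y l) = v' (pos i y l)" for q ys v v'
  proof -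
    have "bad_line L pos v c i y = bad_line L pos v' c i y" if "i \<in> probes q" "y \<in> set ys" for c i y
    proof -
      have "{l \<in> L. v (pos i y l) \<noteq> c (pos i y l)} = {l \<in> L. v' (pos i y l) \<noteq> c (pos i y l)}"
        using same[OF that] by auto
      then show ?thesis by (simp add: bad_line_def)
    qed
    then have "good v x i ys = good v' x i ys" if "i \<in> probes q" for x i
      using that unfolding good_def by (metis (no_types, lifting) filter_cong)
    then have "ok q ys v = ok q ys v'" by (auto simp: ok_def fun_eq_iff)
    then show ?thesis by (simp add: ans_def)
  qed

  have finR: "finite (R q ys)" if "q \<in> Q" for q ys
    unfolding R_def using probes[OF that] fin by blast

  have run: "dt_run w (tree q ys) = ans q ys (\<lambda>j. w ! b' j)" if "q \<in> Q" for q ys w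
  proof -
    have "b' (pos i y l) \<in> R q ys" if "i \<in> probes q" "y \<in> set ys" "l \<in> L" for i y l
      unfolding R_def using that by (intro image_eqI[of _ _ "(i, y, l)"]) auto
    then show ?thesis
      unfolding tree_def dt_run_read_tree using finR[OF that] by (intro ans_cong) simp
  qed

  have Dec_set: "\<exists>ys\<in>Ys. tr = tree q ys" if "tr \<in> set_pmf (Dec q)" for tr q
    using that Ys by (auto simp: Dec_def)

  have valid: "dt_valid N A (tree q ys)" if "q \<in> Q" "ys \<in> Ys" for q ys
  proof -
    have "R q ys \<subseteq> {..<N}"
      using probes[OF that(1)] that(2) b'(1) pos by (fastforce simp: R_def Ys_def)
    moreover have "set_option (ans q ys v) \<subseteq> A" for v
    proof (cases "\<exists>x. ok q ys v x")
      case True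
      then have "ok q ys v (SOME x. ok q ys v x)" by (rule someI_ex)
      then show ?thesis using range that by (auto simp: ans_def ok_def)
    qed (auto simp: ans_def)
    ultimately show ?thesis
      unfolding tree_def using finR[OF that(1)] by (intro dt_valid_read_tree) auto
  qed

  have num: "dt_num_probes w (tree q ys) \<le> t" if "q \<in> Q" "ys \<in> Ys" for q ys w
  proof -
    have p: "finite (probes q)" "card (probes q) \<le> T" using probes[OF that(1)] by auto
    have "card (R q ys) \<le> card (probes q \<times> set ys \<times> L)"
      unfolding R_def by (rule card_image_le) (use p fin in auto)
    also have "\<dots> = card (probes q) * (card (set ys) * card L)" by (simp add: card_cartesian_product)
    also have "\<dots> \<le> T * (r * card L)"
      using p that(2) card_length[of ys] by (intro mult_le_mono) (auto simp: Ys_def)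
    finally show ?thesis using t finR[OF that(1)] by (simp add: tree_def dt_num_probes_read_tree mult_ac)
  qed

  have correct: "measure_pmf.prob (decode Dec w q) {Some (f x q)} \<ge> 1 - \<epsilon>"
    if x: "x \<in> D" and q: "q \<in> Q" and w: "length w = N"
      and err: "real (hamming_dist w (Enc x)) \<le> \<delta> * real N" for x q w
  proof -
    define v where "v = (\<lambda>j. w ! b' j)"
    have "hamming_dist w (Enc x) = card {k. k < N \<and> w ! k \<noteq> enc (enc0 x) (b k)}"
      unfolding hamming_dist_def using w by (intro arg_cong[of _ _ card]) (auto simp: Enc_def)
    also have "\<dots> = card (b ` {k. k < N \<and> w ! k \<noteq> enc (enc0 x) (b k)})"
      using b by (intro card_image[symmetric]) (auto simp: bij_betw_def inj_on_def)
    also have "b ` {k. k < N \<and> w ! k \<noteq> enc (enc0 x) (b k)} = {j \<in> J. v j \<noteq> enc (enc0 x) j}"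
    proof (intro equalityI subsetI)
      fix j assume "j \<in> {j \<in> J. v j \<noteq> enc (enc0 x) j}"
      then show "j \<in> b ` {k. k < N \<and> w ! k \<noteq> enc (enc0 x) (b k)}"
        using b'[of j] by (intro image_eqI[of _ _ "b' j"]) (auto simp: v_def)
    qed (use b b'b in \<open>auto simp: v_def bij_betw_def\<close>)
    finally have "real (card {j \<in> J. v j \<noteq> enc (enc0 x) j}) \<le> 1 / 128 * real N"
      using err \<delta> by (metis (no_types, lifting) mult_right_mono of_nat_0_le_iff order.trans)
    then have few: "128 * card {j \<in> J. v j \<noteq> enc (enc0 x) j} \<le> card J"
      by (simp add: N_def)
    define Bad where "Bad = (\<lambda>i. {ys \<in> Ys. r \<le> 2 * length (filter (bad_line L pos v (enc (enc0 x)) i) ys)})"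
    have Bad: "card (Bad i) * 2 ^ r \<le> card Ys" if "i \<in> probes q" for i
    proof -
      have "i \<in> I" using probes[OF q] that by auto
      from card_majority_bad[OF fin(3) few_bad_lines[OF code this few], of r]
      show ?thesis unfolding Bad_def Ys(3) unfolding Ys_def .
    qed
    \<comment> \<open>The true item \<open>x\<close> passes, and by \<open>majority_decodes\<close>
      the chosen item agrees with \<open>x\<close> on all probed bits, hence has the same
      answer.\<close>
    have ans_ok: "ans q ys v = Some (f x q)" if ys: "ys \<in> Ys" "ys \<notin> (\<Union>i\<in>probes q. Bad i)" for ys
    proof -
      have lys: "set ys \<subseteq> Y" "length ys = r" using ys by (auto simp: Ys_def)
      have okx: "ok q ys v x" using ys x by (auto simp: ok_def good_def Bad_def)
      define x' where "x' = (SOME x. ok q ys v x)"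
      have okx': "ok q ys v x'" unfolding x'_def using okx by (rule someI)
      have "enc0 x' i = enc0 x i" if "i \<in> probes q" for i
        using okx okx' that probes[OF q] lys
        by (intro majority_decodes[OF code, of i ys v "enc0 x'" "enc0 x"]) (auto simp: ok_def good_def)
      then have "f x' q = f x q" using okx' x q by (intro determined) (auto simp: ok_def)
      then show ?thesis using okx by (auto simp: ans_def x'_def)
    qed
    have finBad: "finite (Bad i)" for i using Ys(1) by (simp add: Bad_def)
    have "card (\<Union>i\<in>probes q. Bad i) * 2 ^ r \<le> (\<Sum>i\<in>probes q. card (Bad i)) * 2 ^ r"
      using probes[OF q] by (intro mult_le_mono1 card_UN_le) auto
    also have "\<dots> = (\<Sum>i\<in>probes q. card (Bad i) * 2 ^ r)" by (simp add: sum_distrib_right)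
    also have "\<dots> \<le> (\<Sum>i\<in>probes q. card Ys)" by (intro sum_mono Bad)
    also have "\<dots> \<le> T * card Ys" using probes[OF q] by simp
    finally have "real (card (\<Union>i\<in>probes q. Bad i)) * 2 ^ r \<le> real T * real (card Ys)"
      by (metis (mono_tags, lifting) of_nat_le_iff of_nat_mult of_nat_numeral of_nat_power)
    also have "\<dots> \<le> \<epsilon> * 2 ^ r * real (card Ys)" by (intro mult_right_mono \<epsilon>) simp
    finally have cb: "real (card (\<Union>i\<in>probes q. Bad i)) \<le> \<epsilon> * real (card Ys)" by simp
    have "real (card Ys) - real (card (\<Union>i\<in>probes q. Bad i)) \<le> real (card (Ys - (\<Union>i\<in>probes q. Bad i)))"
      using diff_card_le_card_Diff[of "\<Union>i\<in>probes q. Bad i" Ys] probes[OF q] finBad by force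
    also have "\<dots> \<le> real (card (Ys \<inter> {ys. ans q ys v = Some (f x q)}))"
      using Ys(1) ans_ok by (intro of_nat_mono card_mono) auto
    finally have "(1 - \<epsilon>) * real (card Ys) \<le> real (card (Ys \<inter> {ys. ans q ys v = Some (f x q)}))"
      using cb by (simp add: algebra_simps)
    moreover have "real (card Ys) > 0" using Ys(1,2) by (simp add: card_gt_0_iff)
    ultimately have "1 - \<epsilon> \<le> measure_pmf.prob (pmf_of_set Ys) {ys. ans q ys v = Some (f x q)}"
      using Ys(1,2) by (simp add: measure_pmf_of_set pos_le_divide_eq)
    also have "\<dots> = measure_pmf.prob (decode Dec w q) {Some (f x q)}"
      by (simp add: decode_def Dec_def measure_map_pmf vimage_def run[OF q] v_def pmf.map_comp comp_def)
    finally show ?thesis .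
  qed

  have valid': "dt_valid N A tr" and num': "dt_num_probes w tr \<le> t"
    if "q \<in> Q" "tr \<in> set_pmf (Dec q)" for q tr w
    using Dec_set[OF that(2)] valid[OF that(1)] num[OF that(1)] by auto

  have good_all: "good_queries Q (f x) Dec w \<epsilon> = Q"
    if "x \<in> D" "length w = N" "real (hamming_dist w (Enc x)) \<le> \<delta> * real N" for x w
    using correct that by (auto simp: good_queries_def)
  have safe: "measure_pmf.prob (decode Dec w q) {Some (f x q), None} \<ge> 1 - \<epsilon>"
    if "x \<in> D" "q \<in> Q" "length w = N" "real (hamming_dist w (Enc x)) \<le> \<delta> * real N" for x q w
    by (rule order.trans[OF correct[OF that]]) (intro measure_pmf.finite_measure_mono; simp)
  have "(1 - lam) * real (card Q) \<le> real (card Q)"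
    using lam by (simp add: algebra_simps)
  moreover have "length (Enc x) = N" for x by (simp add: Enc_def)
  ultimately show ?thesis
    unfolding has_data_structure_def N_def[symmetric]
    using valid' num' safe good_all
    by (intro exI[of _ Enc] exI[of _ Dec]) auto
qed

section \<open>Choice of the parameters\<close>

text \<open>With \<open>d = u ^ c\<close> and \<open>m\<close> minimal,
  \<open>d ^ (m - 1) \<le> s\<close>. As \<open>3 \<le> c * \<eta>\<close>, the factor
  \<open>u ^ 3\<close> is at most \<open>d powr \<eta>\<close>, so the power is at most
  \<open>s powr (1 + \<eta>)\<close> times \<open>d powr (4 * (1 + \<eta>))\<close>, and the last
  factor is at most \<open>d ^ 8\<close>.\<close>

lemma digit_parameters:
  fixes s u c :: nat and \<eta> :: real
  assumes s: "1 \<le> s" "s < 2 ^ u" and u: "2 \<le> u" and c: "3 \<le> real c * \<eta>" and \<eta>: "0 < \<eta>" "\<eta> \<le> 1"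
  shows "\<exists>m. 1 \<le> m \<and> m \<le> u \<and> s < (u ^ c) ^ m \<and>
           real ((u ^ 3 * u ^ c) ^ (m + 3)) \<le> real s powr (1 + \<eta>) * real (u ^ (8 * c))"
proof -
  have c1: "1 \<le> c" using c \<eta> by (cases c) auto
  define d where "d = u ^ c"
  have d2: "2 \<le> d"
    using u c1 power_increasing[of 1 c u] by (simp add: d_def)
  have "s < d ^ u" using s(2) power_mono[OF d2, of u] by simp
  define m where "m = (LEAST m. s < d ^ m)"
  have m: "s < d ^ m" unfolding m_def by (rule LeastI) fact
  have mu: "m \<le> u" unfolding m_def by (rule Least_le) fact
  have m1: "1 \<le> m" using m s(1) by (cases m) auto
  have "\<not> s < d ^ (m - 1)" using m1 unfolding m_def by (intro not_less_Least) (simp add: m_def)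
  then have dm: "real d ^ (m - 1) \<le> real s" by (metis not_less of_nat_le_iff of_nat_power)
  have d0: "real d > 0" "real d \<ge> 1" using d2 by auto
  have "real (u ^ 3) = real u powr 3" using u by (simp add: powr_numeral)
  also have "\<dots> \<le> real u powr (real c * \<eta>)" using u c by (intro powr_mono) auto
  also have "\<dots> = real d powr \<eta>" using u by (simp add: d_def powr_powr[symmetric] powr_realpow)
  finally have "real (u ^ 3 * d) \<le> real d powr \<eta> * real d" using d0 by simp
  also have "\<dots> = real d powr (1 + \<eta>)" using d0 by (simp add: powr_add)
  finally have "real ((u ^ 3 * d) ^ (m + 3)) \<le> (real d powr (1 + \<eta>)) ^ (m + 3)"
    by (simp only: of_nat_power) (rule power_mono, auto)
  also have "\<dots> = (real d powr (1 + \<eta>)) ^ (m - 1) * (real d powr (1 + \<eta>)) ^ 4"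
    using m1 by (simp add: add.commute flip: power_add)
  also have "\<dots> = (real d ^ (m - 1)) powr (1 + \<eta>) * real d powr (4 * (1 + \<eta>))"
    using d0 by (simp add: powr_powr powr_realpow[symmetric] mult.commute)
  also have "\<dots> \<le> real s powr (1 + \<eta>) * real d powr 8"
    using d0 dm \<eta> by (intro mult_mono powr_mono2 powr_mono) auto
  also have "real d powr 8 = real (u ^ (8 * c))" using d0
    by (simp add: powr_numeral d_def mult.commute flip: power_mult)
  finally have "real ((u ^ 3 * d) ^ (m + 3)) \<le> real s powr (1 + \<eta>) * real (u ^ (8 * c))" .
  with m mu m1 show ?thesis unfolding d_def by blast
qed

text \<open>For \<open>K = u ^ (c + 3)\<close>, the bound \<open>u \<le> 2 ^ u\<close> gives
  \<open>K ^ (8 * u ^ (c + 1)) \<le> 2 ^ k\<close> with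
  \<open>k = 8 * (c + 3) * u ^ (c + 2)\<close>. The size of \<open>u\<close> ensures
  \<open>2 * k \<le> K\<close>, so the least common multiple is large enough.\<close>

lemma prime_for_code:
  fixes u c :: nat
  assumes u: "16 * (c + 3) \<le> u"
  shows "\<exists>q. prime q \<and> 8 * (u * u ^ c) < q \<and> q \<le> u ^ 3 * u ^ c"
proof (rule exists_prime_between)
  define K where "K = u ^ 3 * u ^ c"
  define k where "k = 8 * (c + 3) * u ^ (c + 2)"
  have u0: "0 < u" using u by simp
  have "2 * k = 16 * (c + 3) * u ^ (c + 2)" by (simp add: k_def)
  also have "\<dots> \<le> u * u ^ (c + 2)" by (intro mult_le_mono1 u)
  finally have kK: "2 * k \<le> K" by (simp add: K_def power_add power2_eq_square power3_eq_cube mult_ac)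
  have "K \<le> (2 ^ u) ^ (c + 3)"
    using power_mono[of u "2 ^ u" "c + 3"] by (simp add: K_def less_imp_le mult.commute flip: power_add)
  then have "K ^ (8 * (u * u ^ c)) \<le> ((2 ^ u) ^ (c + 3)) ^ (8 * (u * u ^ c))" by (rule power_mono) simp
  also have "\<dots> = 2 ^ k" by (simp add: k_def mult_ac power2_eq_square flip: power_mult power_add)
  also have "\<dots> < Lcm {1..2 * k}"
  proof (rule two_power_less_Lcm)
    have "1 \<le> u ^ (c + 2)" using u0 by simp
    then have "8 * (c + 3) * 1 \<le> k" unfolding k_def by (rule mult_le_mono2)
    then show "2 \<le> k" by simp
  qed
  also have "\<dots> \<le> Lcm {1..K}"
    by (intro dvd_imp_le Lcm_subset) (use kK in \<open>auto simp: Lcm_0_iff intro!: Nat.gr0I\<close>)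
  finally show "K ^ (8 * (u * u ^ c)) < Lcm {1..K}" .
  show "0 < K" using u0 by (simp add: K_def)
qed

lemma smooth_code_of_length:
  fixes I :: "'i set" and u c :: nat and \<eta> :: real
  assumes I: "finite I" "1 \<le> card I" "card I < 2 ^ u"
    and u: "16 * (c + 3) \<le> u" and c: "3 \<le> real c * \<eta>" and \<eta>: "0 < \<eta>" "\<eta> \<le> 1"
  shows "\<exists>(J :: ((nat \<Rightarrow> int) \<times> int \<times> int) set) (L :: (int \<times> int \<times> int) set) (Y :: (nat \<Rightarrow> int) set) enc pos.
    smooth_code I J L Y enc pos \<and> card L \<le> u ^ (3 * (c + 3)) \<and>
    real (card J) \<le> real (card I) powr (1 + \<eta>) * real (u ^ (8 * c))"
proof -
  obtain m where m: "1 \<le> m" "m \<le> u" "card I < (u ^ c) ^ m"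
    "real ((u ^ 3 * u ^ c) ^ (m + 3)) \<le> real (card I) powr (1 + \<eta>) * real (u ^ (8 * c))"
    using digit_parameters[OF I(2,3) _ c \<eta>] u by auto
  obtain q where q: "prime q" "8 * (u * u ^ c) < q" "q \<le> u ^ 3 * u ^ c"
    using prime_for_code[OF u] by blast
  have "8 * (m * u ^ c) \<le> 8 * (u * u ^ c)" using m(2) by simp
  then have mq: "8 * (m * u ^ c) < q" using q(2) by linarith
  obtain J :: "((nat \<Rightarrow> int) \<times> int \<times> int) set" and L :: "(int \<times> int \<times> int) set"
      and Y :: "(nat \<Rightarrow> int) set" and enc pos
    where code: "smooth_code I J L Y enc pos" "card J = q ^ (m + 2)" "card L \<le> q ^ 3"
    using smooth_code_exists[OF I(1) less_imp_le[OF m(3)] q(1) _ _ mq] m(1) u by auto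
  have "card L \<le> (u ^ 3 * u ^ c) ^ 3" using code(3) power_mono[OF q(3), of 3] by linarith
  also have "\<dots> = u ^ (3 * (c + 3))" by (simp add: mult.commute add.commute flip: power_add power_mult)
  finally have L: "card L \<le> u ^ (3 * (c + 3))" .
  have "q ^ (m + 2) \<le> q ^ (m + 3)" using q(1) by (intro power_increasing) (auto simp: prime_gt_0_nat Suc_leI)
  also have "\<dots> \<le> (u ^ 3 * u ^ c) ^ (m + 3)" by (intro power_mono q) simp
  finally have "real (card J) \<le> real ((u ^ 3 * u ^ c) ^ (m + 3))" using code(2) by (simp only: of_nat_le_iff)
  with m(4) have "real (card J) \<le> real (card I) powr (1 + \<eta>) * real (u ^ (8 * c))" by linarith
  with code(1) L show ?thesis by blast
qed

text \<open>Here \<open>u\<close> bounds the logarithms of \<open>s\<close> and \<open>l\<close>.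
  The digit parameters are chosen twice, for the exponents of the polynomial and for the indices of
  the resulting table, which accounts for the two exponents \<open>1 + \<eta>\<close>.\<close>

lemma PolyEval_data_structure:
  fixes n s l u c r t :: nat and \<epsilon> \<eta> \<delta> lam :: real
  assumes n: "1 \<le> n" "n \<le> 2 ^ l" "1 \<le> l" "l \<le> 2 ^ u" and s: "1 \<le> s" "s < 2 ^ u"
    and u: "16 * (c + 3) \<le> u" and c: "3 \<le> real c * \<eta>" and \<eta>: "0 < \<eta>" "\<eta> \<le> 1"
    and \<epsilon>: "1 / \<epsilon> \<le> 2 ^ r" "0 < \<epsilon>" and \<delta>: "\<delta> \<le> 1 / 128" and lam: "0 \<le> lam"
    and t: "t = l * (3 * c + 10 + r) * (9 * c + 10) ^ (3 * (c + 3)) * u ^ (6 * c + 20)"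
  shows "\<exists>N. PolyEval_has_data_structure n s t \<delta> \<epsilon> lam N \<and>
     real N \<le> (real l * real s powr (1 + \<eta>) * real (u ^ (9 * c + 3))) powr (1 + \<eta>) *
        real (((9 * c + 10) * u) ^ (8 * c))"
proof -
  define d where "d = u ^ c"
  have u16: "16 \<le> u" and u48: "8 * (c + 3) \<le> u" using u by auto
  have d1: "1 \<le> d" using u16 by (simp add: d_def)
  obtain m where m: "1 \<le> m" "m \<le> u" "s < d ^ m"
    "real ((u ^ 3 * d) ^ (m + 3)) \<le> real s powr (1 + \<eta>) * real (u ^ (8 * c))"
    using digit_parameters[OF s _ c \<eta>] u16 unfolding d_def by auto
  define K1 where "K1 = 4 * (m * d + 1) * l"
  \<comment> \<open>Since \<open>K1 \<le> u ^ (c + 2) * l\<close>, the exponents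
    \<open>(c + 2) * u\<close> and \<open>u\<close> of the two factors add up to this value.\<close>
  define \<mu> where "\<mu> = (c + 3) * u"
  define K2 where "K2 = 4 * (m * d + 1) * \<mu>"
  have md: "4 * (m * d + 1) \<le> 8 * u ^ (c + 1)"
  proof -
    have "1 \<le> m * d" using m(1) d1 by (cases m; cases d) auto
    moreover have "m * d \<le> u ^ (c + 1)" using m(2) by (simp add: d_def)
    moreover have "4 * (x + 1) \<le> 8 * y" if "1 \<le> x" "x \<le> y" for x y :: nat
      using that by simp
    ultimately show ?thesis by blast
  qed
  have u2: "u \<le> 2 ^ u" by (simp add: less_imp_le)
  have upow: "u ^ k \<le> 2 ^ (u * k)" for k using power_mono[OF u2, of k] by (simp add: power_mult)
  have K1_le: "K1 \<le> u ^ (c + 2) * l"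
  proof -
    have "8 * u ^ (c + 1) \<le> u * u ^ (c + 1)" using u16 by (intro mult_le_mono1) simp
    with md have "4 * (m * d + 1) \<le> u * u ^ (c + 1)" by (rule order.trans)
    also have "\<dots> = u ^ (c + 2)" by simp
    finally show ?thesis unfolding K1_def by (rule mult_le_mono1)
  qed
  have K1\<mu>: "K1 \<le> 2 ^ \<mu>"
  proof -
    have "u ^ (c + 2) * l \<le> 2 ^ (u * (c + 2)) * 2 ^ u" by (intro mult_le_mono upow n)
    also have "\<dots> = 2 ^ \<mu>" by (simp add: \<mu>_def algebra_simps flip: power_add)
    finally show ?thesis using K1_le by linarith
  qed
  have K2_le: "K2 \<le> u ^ 3 * d"
  proof -
    have "K2 \<le> 8 * u ^ (c + 1) * ((c + 3) * u)" unfolding K2_def \<mu>_def by (rule mult_le_mono1[OF md])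
    also have "\<dots> = (8 * (c + 3)) * u ^ (c + 2)" by (simp add: mult_ac)
    also have "\<dots> \<le> u * u ^ (c + 2)" by (rule mult_le_mono1[OF u48])
    also have "\<dots> = u ^ 3 * d" by (simp add: d_def power3_eq_cube power2_eq_square power_add mult_ac)
    finally show ?thesis .
  qed
  have K_pos: "0 < K1" "0 < K2" using n u16 by (auto simp: K1_def K2_def \<mu>_def)

  define I where "I = residue_index m K1 K2"
  have cI: "finite I" "card I = K1 * K2 ^ (m + 2)" unfolding I_def by (rule card_residue_index)+
  have cI1: "1 \<le> card I" using K_pos by (simp add: cI Suc_le_eq)
  have "K2 ^ (m + 2) \<le> (u ^ 3 * d) ^ (m + 2)" by (intro power_mono K2_le) simp
  also have "\<dots> \<le> (u ^ 3 * d) ^ (m + 3)" using u16 d1 by (intro power_increasing) auto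
  finally have "real (K2 ^ (m + 2)) \<le> real ((u ^ 3 * d) ^ (m + 3))" by (simp only: of_nat_le_iff)
  then have K2m: "real (K2 ^ (m + 2)) \<le> real s powr (1 + \<eta>) * real (u ^ (8 * c))" using m(4) by linarith
  have "real (card I) \<le> real (u ^ (c + 2) * l) * (real s powr (1 + \<eta>) * real (u ^ (8 * c)))"
    unfolding cI of_nat_mult[of K1] using K1_le by (intro mult_mono K2m) (auto simp only: of_nat_le_iff of_nat_0_le_iff)
  also have "\<dots> = real l * real s powr (1 + \<eta>) * real (u ^ (9 * c + 2))"
    by (simp add: mult_ac flip: power_add)
  also have "\<dots> \<le> real l * real s powr (1 + \<eta>) * real (u ^ (9 * c + 3))"
  proof (rule mult_left_mono)
    have "u ^ (9 * c + 2) \<le> u ^ (9 * c + 3)" using u16 by (intro power_increasing) auto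
    then show "real (u ^ (9 * c + 2)) \<le> real (u ^ (9 * c + 3))" by (simp only: of_nat_le_iff)
  qed simp
  finally have cI_le: "real (card I) \<le> real l * real s powr (1 + \<eta>) * real (u ^ (9 * c + 3))" .

  \<comment> \<open>The bounds on \<open>l\<close>, \<open>s ^ 2\<close> and
    \<open>u ^ (9 * c + 3)\<close> contribute exponents \<open>u\<close>, \<open>2 * u\<close> and
    \<open>(9 * c + 3) * u\<close>; the total is below \<open>u'\<close>.\<close>
  define u' where "u' = (9 * c + 10) * u"
  have cI_less: "card I < 2 ^ u'"
  proof -
    have "real s powr (1 + \<eta>) \<le> real s powr 2" using s \<eta> by (intro powr_mono) auto
    also have "\<dots> = real (s ^ 2)" using s by (simp add: powr_numeral)
    finally have "real (card I) \<le> real l * real (s ^ 2) * real (u ^ (9 * c + 3))"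
      using cI_le by (meson mult_left_mono mult_right_mono of_nat_0_le_iff order.trans)
    then have "card I \<le> l * s ^ 2 * u ^ (9 * c + 3)" by (simp only: of_nat_le_iff of_nat_mult[symmetric])
    also have "\<dots> \<le> 2 ^ u * (2 ^ u) ^ 2 * 2 ^ (u * (9 * c + 3))"
      using n s by (intro mult_le_mono upow power_mono) auto
    also have "\<dots> = 2 ^ (u + u * 2 + u * (9 * c + 3))" by (simp only: power_add power_mult)
    also have "\<dots> < 2 ^ u'" using u16 by (intro power_strict_increasing) (auto simp: u'_def algebra_simps)
    finally show ?thesis .
  qed
  have "u \<le> u'" by (simp add: u'_def)
  then have u': "16 * (c + 3) \<le> u'" using u by linarith
  obtain J :: "((nat \<Rightarrow> int) \<times> int \<times> int) set" and L :: "(int \<times> int \<times> int) set"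
      and Y :: "(nat \<Rightarrow> int) set" and enc pos
    where code: "smooth_code I J L Y enc pos" and L: "card L \<le> u' ^ (3 * (c + 3))"
      and J: "real (card J) \<le> real (card I) powr (1 + \<eta>) * real (u' ^ (8 * c))"
    using smooth_code_of_length[OF cI(1) cI1 cI_less u' c \<eta>] by blast

  define T where "T = K1 * K2 ^ 2"
  have T: "T \<le> l * u ^ (3 * c + 8)"
  proof -
    have "T \<le> (u ^ (c + 2) * l) * (u ^ 3 * d) ^ 2"
      unfolding T_def by (intro mult_le_mono power_mono K1_le K2_le) simp
    also have "\<dots> = l * (u ^ (c + 2) * u ^ (3 * 2) * u ^ (c * 2))"
      by (simp only: d_def power_mult_distrib power_mult[symmetric] mult_ac)
    also have "u ^ (c + 2) * u ^ (3 * 2) * u ^ (c * 2) = u ^ (c + 2 + 3 * 2 + c * 2)"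
      by (simp only: power_add)
    also have "c + 2 + 3 * 2 + c * 2 = 3 * c + 8" by simp
    finally show ?thesis .
  qed
  \<comment> \<open>The first summand outweighs the number \<open>T\<close> of table bits in the
    union bound, and \<open>r\<close> supplies the factor \<open>1 / \<epsilon>\<close>.\<close>
  define R where "R = (3 * c + 9) * u + r"
  have TR: "real T \<le> \<epsilon> * 2 ^ R"
  proof -
    have "l * u ^ (3 * c + 8) \<le> 2 ^ u * 2 ^ (u * (3 * c + 8))" by (intro mult_le_mono upow n)
    also have "\<dots> = 2 ^ ((3 * c + 9) * u)" by (simp add: algebra_simps flip: power_add)
    finally have "real T \<le> real (2 ^ ((3 * c + 9) * u))" using T by (simp only: of_nat_le_iff)
    also have "\<dots> \<le> \<epsilon> * 2 ^ r * 2 ^ ((3 * c + 9) * u)"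
    proof -
      have "1 \<le> \<epsilon> * 2 ^ r" using \<epsilon> by (simp add: divide_le_eq mult.commute)
      then show ?thesis using mult_right_mono[of 1 "\<epsilon> * 2 ^ r" "2 ^ ((3 * c + 9) * u)"] by simp
    qed
    finally show ?thesis by (simp add: R_def power_add mult_ac)
  qed
  have "T * R * card L \<le> (l * u ^ (3 * c + 8)) * ((3 * c + 10 + r) * u) * u' ^ (3 * (c + 3))"
  proof (intro mult_le_mono T L)
    have "r \<le> r * u" using u16 by simp
    then have "R \<le> (3 * c + 9) * u + r * u" unfolding R_def by (rule add_left_mono)
    also have "\<dots> \<le> (3 * c + 10 + r) * u" by (simp add: algebra_simps)
    finally show "R \<le> (3 * c + 10 + r) * u" .
  qed
  also have "\<dots> = l * (3 * c + 10 + r) * (9 * c + 10) ^ (3 * (c + 3)) * (u ^ (3 * c + 8) * u * u ^ (3 * (c + 3)))"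
    by (simp only: u'_def power_mult_distrib mult_ac)
  also have "u ^ (3 * c + 8) * u * u ^ (3 * (c + 3)) = u ^ (3 * c + 8 + 1 + 3 * (c + 3))"
    by (simp only: power_add power_one_right)
  also have "3 * c + 8 + 1 + 3 * (c + 3) = 6 * c + 18" by simp
  also have "l * (3 * c + 10 + r) * (9 * c + 10) ^ (3 * (c + 3)) * u ^ (6 * c + 18) \<le> t"
    unfolding t using u16 by (intro mult_le_mono2 power_increasing) auto
  finally have t_le: "T * R * card L \<le> t" .

  have "has_data_structure (Zmod_polys n s) (Zmod n) (Zmod n) (poly_eval_mod n) t \<delta> \<epsilon> lam (card J)"
  proof (rule has_data_structure_of_smooth_code[OF code])
    fix a
    show "finite (residue_probes m K1 K2 (power_point n d a)) \<and>
        residue_probes m K1 K2 (power_point n d a) \<subseteq> I \<and>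
        card (residue_probes m K1 K2 (power_point n d a)) \<le> T"
      using residue_probes cI(1) unfolding I_def T_def by (metis finite_subset)
  next
    fix g g' a
    assume "g \<in> Zmod_polys n s" "g' \<in> Zmod_polys n s" "a \<in> Zmod n"
      and "\<And>i. i \<in> residue_probes m K1 K2 (power_point n d a) \<Longrightarrow>
        residue_bit d m (coeff_nat g) i = residue_bit d m (coeff_nat g') i"
    then show "poly_eval_mod n g a = poly_eval_mod n g' a"
      by (rule poly_eval_determined[OF _ _ _ m(3) n(2,3) d1 K1_def K1\<mu> K2_def])
  next
    show "poly_eval_mod n g a \<in> Zmod n" for g a
      using n(1) by (simp add: poly_eval_mod_def Zmod_def)
  qed (use TR \<delta> lam t_le in auto)
  moreover have "real (card J) \<le> (real l * real s powr (1 + \<eta>) * real (u ^ (9 * c + 3))) powr (1 + \<eta>) *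
        real (((9 * c + 10) * u) ^ (8 * c))"
  proof -
    have "real (card I) powr (1 + \<eta>) \<le> (real l * real s powr (1 + \<eta>) * real (u ^ (9 * c + 3))) powr (1 + \<eta>)"
      using cI_le \<eta> by (intro powr_mono2) auto
    then show ?thesis using J unfolding u'_def by (meson mult_right_mono of_nat_0_le_iff order.trans)
  qed
  ultimately show ?thesis unfolding PolyEval_has_data_structure_def by blast
qed

section \<open>Asymptotic bounds\<close>

text \<open>Apply \<open>log 2 X \<le> X powr b / (b * ln 2)\<close> with
  \<open>b = a / (w + 1)\<close>; the successor avoids division by zero when
  \<open>w = 0\<close>.\<close>

lemma polylog_le_powr:
  fixes B a :: real
  assumes "0 \<le> B" "0 < a"
  shows "\<exists>C\<ge>0. \<forall>X\<ge>1. (B + log 2 X) ^ w \<le> C * X powr a"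
proof -
  define b where "b = a / real (Suc w)"
  have b: "0 < b" using assms by (simp add: b_def)
  have ba: "real w * b \<le> a" using assms by (simp add: b_def field_simps)
  define D where "D = B + 1 / (b * ln 2)"
  have D: "0 \<le> D" using assms b by (simp add: D_def)
  have "(B + log 2 X) ^ w \<le> D ^ w * X powr a" if X: "1 \<le> X" for X
  proof -
    have "log 2 X \<le> (X powr b / b) / ln 2"
      unfolding log_def by (intro divide_right_mono ln_powr_bound X b) simp
    moreover have "B \<le> B * X powr b"
      using X assms b ge_one_powr_ge_zero[of X b] by (simp add: mult_le_cancel_left1)
    ultimately have "B + log 2 X \<le> D * X powr b"
      by (simp add: D_def algebra_simps)
    moreover have "0 \<le> B + log 2 X" using X assms by simp
    ultimately have "(B + log 2 X) ^ w \<le> (D * X powr b) ^ w" by (intro power_mono)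
    also have "\<dots> = D ^ w * X powr (real w * b)"
      using X by (simp add: power_mult_distrib powr_powr mult.commute flip: powr_realpow)
    also have "\<dots> \<le> D ^ w * X powr a"
      using X D ba by (intro mult_left_mono powr_mono) auto
    finally show ?thesis .
  qed
  then show ?thesis using D by (intro exI[of _ "D ^ w"]) auto
qed

lemma le_two_power_ceiling_log:
  assumes "1 \<le> X"
  shows "X \<le> 2 ^ nat \<lceil>log 2 X\<rceil>" and "real (nat \<lceil>log 2 X\<rceil>) \<le> log 2 X + 1"
proof -
  have l: "0 \<le> log 2 X" using assms by simp
  then have "log 2 X \<le> real (nat \<lceil>log 2 X\<rceil>)" by linarith
  then show "X \<le> 2 ^ nat \<lceil>log 2 X\<rceil>"
    using assms by (metis log_le_iff less_le_trans numeral_One one_less_numeral_iff powr_realpow semiring_norm(76) zero_less_numeral zero_less_one)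
  show "real (nat \<lceil>log 2 X\<rceil>) \<le> log 2 X + 1" using l by linarith
qed

text \<open>For \<open>n = 1\<close> the logarithm vanishes and the length bound becomes 0, so the
  empty string must do; the only possible answer is 0.\<close>

lemma PolyEval_trivial:
  assumes "0 < \<epsilon>" "0 < lam"
  shows "PolyEval_has_data_structure 1 s 1 \<delta> \<epsilon> lam 0"
proof -
  have Z: "Zmod 1 = {0}" by (auto simp: Zmod_def)
  have p: "poly_eval_mod (Suc 0) g a = 0" for g a by (simp add: poly_eval_mod_def)
  show ?thesis
    unfolding PolyEval_has_data_structure_def has_data_structure_def Z
    by (intro exI[of _ "\<lambda>_. []"] exI[of _ "\<lambda>_. return_pmf (Output (Some 0))"])
      (use assms in \<open>auto simp: decode_def good_queries_def p algebra_simps\<close>)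
qed

theorem theorem2:
  fixes \<epsilon> lam \<eta> :: real
  assumes "0 < \<epsilon>" and "\<epsilon> < 1" and "0 < lam" and "lam < 1" and "0 < \<eta>" and "\<eta> < 1"
  shows "\<exists>(\<tau> :: real) (C :: real) (p :: real poly) (h :: nat \<Rightarrow> real).
           0 < \<tau> \<and> \<tau> < 1 \<and> h \<longlonglongrightarrow> 0 \<and>
           (\<forall>(s :: nat) (n :: nat) (\<delta> :: real).
              1 \<le> s \<and> s \<le> n \<and> 0 \<le> \<delta> \<and> \<delta> \<le> \<tau> \<longrightarrow>
              (\<exists>(t :: nat) (N :: nat).
                 0 < t \<and>
                 PolyEval_has_data_structure n s t \<delta> \<epsilon> lam N \<and>
                 (2 \<le> n \<longrightarrow> real t \<le> C * (poly p (log 2 (real s)) * log 2 (real n) powr (1 + h n))) \<and>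
                 real N \<le> C * (real s * log 2 (real n)) powr (1 + \<eta>)))"
proof -
  \<comment> \<open>The nested exponents give
    \<open>(1 + \<beta>) * (1 + \<beta>) \<le> 1 + 3 * \<beta>\<close>, and absorbing
    polylogarithmic factors costs another \<open>\<beta>\<close>.\<close>
  define \<beta> where "\<beta> = \<eta> / 4"
  have \<beta>: "0 < \<beta>" "\<beta> \<le> 1" "\<eta> = 4 * \<beta>" using assms by (auto simp: \<beta>_def)
  define c where "c = nat \<lceil>3 / \<beta>\<rceil>"
  have "3 / \<beta> \<le> real c" unfolding c_def by linarith
  then have c: "3 \<le> real c * \<beta>" using \<beta> by (simp add: pos_divide_le_eq)
  obtain r where r: "1 / \<epsilon> \<le> 2 ^ r"
    using real_arch_pow[of 2 "1 / \<epsilon>"] by (auto intro: less_imp_le)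
  define u0 where "u0 = 16 * (c + 3) + 1"
  define w where "w = 6 * c + 20"
  define A where "A = real u0 + 2"
  define p :: "real poly" where "p = [:A, 1:] ^ w"
  \<comment> \<open>Chosen so that \<open>log 2 n powr h n\<close> equals
    \<open>(1 + log 2 (log 2 n)) ^ w\<close>. At \<open>n = 2\<close> the division by zero yields 0,
    which matches \<open>1 ^ w\<close>.\<close>
  define h where "h = (\<lambda>n. real w * ln (1 + log 2 (log 2 (real n))) / ln (log 2 (real n)))"
  have h: "h \<longlonglongrightarrow> 0" unfolding h_def by real_asymp
  define Ct where "Ct = (3 * c + 10 + r) * (9 * c + 10) ^ (3 * (c + 3))"
  define w' where "w' = 2 * (9 * c + 3) + 8 * c"
  obtain C1 where C1: "0 \<le> C1" "\<And>X. 1 \<le> X \<Longrightarrow> (real u0 + 1 + log 2 X) ^ w' \<le> C1 * X powr \<beta>"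
    using polylog_le_powr[of "real u0 + 1" \<beta> w'] \<beta>(1) by auto
  define Cn where "Cn = real ((9 * c + 10) ^ (8 * c)) * C1 * 4"
  define C where "C = 2 * real Ct + Cn"
  have C: "2 * real Ct \<le> C" "Cn \<le> C" "0 \<le> C" using C1 by (auto simp: C_def Cn_def)

  have main: "\<exists>t N. 0 < t \<and> PolyEval_has_data_structure n s t \<delta> \<epsilon> lam N \<and>
        real t \<le> C * (poly p (log 2 (real s)) * log 2 (real n) powr (1 + h n)) \<and>
        real N \<le> C * (real s * log 2 (real n)) powr (1 + \<eta>)"
    if s: "1 \<le> s" and n: "2 \<le> n" and \<delta>: "\<delta> \<le> 1 / 128" for s n :: nat and \<delta> :: real
  proof -
    have ln1: "1 \<le> log 2 (real n)" using n by (simp add: le_log_iff)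
    define l where "l = nat \<lceil>log 2 (real n)\<rceil>"
    have n_l: "n \<le> 2 ^ l"
      using le_two_power_ceiling_log(1)[of "real n"] n unfolding l_def
      by (metis (mono_tags, lifting) One_nat_def Suc_le_lessD le_trans nat_le_real_less numeral_2_eq_2 of_nat_1 of_nat_le_iff of_nat_numeral of_nat_power one_le_numeral)
    have l1: "1 \<le> l" unfolding l_def using ln1 by linarith
    have l2: "real l \<le> 2 * log 2 (real n)"
      using le_two_power_ceiling_log(2)[of "real n"] n ln1 unfolding l_def by linarith
    define X where "X = real s * real l"
    have X: "1 \<le> X" "real s \<le> X" "real l \<le> X"
      using s l1 mult_mono[of 1 "real s" 1 "real l"] by (auto simp: X_def)
    define u where "u = u0 + nat \<lceil>log 2 X\<rceil>"
    have Xu: "X < 2 ^ u"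
    proof -
      have "2 ^ nat \<lceil>log 2 X\<rceil> < (2::real) ^ u"
        by (rule power_strict_increasing) (simp_all add: u_def u0_def)
      then show ?thesis using le_two_power_ceiling_log(1)[OF X(1)] by linarith
    qed
    have "real s < 2 ^ u" "real l < 2 ^ u" using X Xu by linarith+
    then have su: "s < 2 ^ u" and lu: "l \<le> 2 ^ u" by simp_all
    have uX: "real u \<le> real u0 + 1 + log 2 X"
      using le_two_power_ceiling_log(2)[OF X(1)] by (simp add: u_def)
    have u1: "1 \<le> real u" by (simp add: u_def u0_def)

    define t where "t = l * (3 * c + 10 + r) * (9 * c + 10) ^ (3 * (c + 3)) * u ^ (6 * c + 20)"
    obtain N where N: "PolyEval_has_data_structure n s t \<delta> \<epsilon> lam N"
      "real N \<le> (real l * real s powr (1 + \<beta>) * real (u ^ (9 * c + 3))) powr (1 + \<beta>) *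
        real (((9 * c + 10) * u) ^ (8 * c))"
      using PolyEval_data_structure[OF _ n_l l1 lu s su _ c \<beta>(1,2) r assms(1) \<delta> _ t_def, of lam] n assms
      by (auto simp: u_def u0_def)

    have "0 < t" using l1 by (simp add: t_def u_def u0_def)
    moreover have "real t \<le> C * (poly p (log 2 (real s)) * log 2 (real n) powr (1 + h n))"
    proof -
      define y where "y = log 2 (real s)"
      define z where "z = log 2 (log 2 (real n))"
      have yz: "0 \<le> y" "0 \<le> z" using s ln1 by (simp_all add: y_def z_def)
      have "log 2 (real l) \<le> log 2 (2 * log 2 (real n))" using l1 l2 ln1 by simp
      also have "\<dots> = 1 + z" using ln1 by (simp add: z_def log_mult)
      finally have "log 2 X \<le> y + 1 + z" using s l1 by (simp add: X_def y_def log_mult)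
      then have "real u \<le> A + y + z" using uX by (simp add: A_def)
      \<comment> \<open>Passing from a sum to a product separates the dependence on
        \<open>s\<close>, which goes into \<open>p\<close>, from that on \<open>n\<close>, which
        goes into \<open>h\<close>.\<close>
      also have "\<dots> \<le> (A + y) * (1 + z)"
      proof -
        have "1 * z \<le> (A + y) * z" by (rule mult_right_mono) (use yz in \<open>auto simp: A_def\<close>)
        then show ?thesis by (simp add: algebra_simps)
      qed
      finally have "real u ^ w \<le> ((A + y) * (1 + z)) ^ w" by (intro power_mono) auto
      also have "\<dots> = poly p y * (1 + z) ^ w" by (simp add: p_def power_mult_distrib)
      also have "(1 + z) ^ w = log 2 (real n) powr h n"
      proof (cases "n = 2")
        case True
        then show ?thesis by (simp add: z_def)
      next
        case False
        then have "1 < log 2 (real n)" using n by (simp add: less_log_iff)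
        then have "log 2 (real n) powr h n = exp (real w * ln (1 + z))"
          by (simp add: powr_def h_def z_def)
        also have "\<dots> = (1 + z) ^ w" using yz by (simp add: exp_of_nat_mult)
        finally show ?thesis by simp
      qed
      finally have uw: "real u ^ w \<le> poly p y * log 2 (real n) powr h n" .
      have pos: "0 \<le> poly p y * log 2 (real n) powr h n" using uw by (meson of_nat_0_le_iff order.trans zero_le_power)
      have "real t = real l * real Ct * real u ^ w"
        by (simp add: t_def Ct_def w_def)
      also have "\<dots> \<le> (2 * log 2 (real n)) * real Ct * (poly p y * log 2 (real n) powr h n)"
        using l2 uw ln1 by (intro mult_mono) auto
      also have "\<dots> = (2 * real Ct) * (poly p y * log 2 (real n) powr (1 + h n))"
        using ln1 by (simp add: powr_add mult_ac)
      also have "\<dots> \<le> C * (poly p y * log 2 (real n) powr (1 + h n))"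
        using C pos ln1 by (intro mult_right_mono) (auto simp: powr_add mult_ac zero_le_mult_iff)
      finally show ?thesis by (simp add: y_def)
    qed
    moreover have "real N \<le> C * (real s * log 2 (real n)) powr (1 + \<eta>)"
    proof -
      have X4: "X powr (1 + \<eta>) \<le> 4 * (real s * log 2 (real n)) powr (1 + \<eta>)"
      proof -
        have "X \<le> 2 * (real s * log 2 (real n))"
          using mult_left_mono[OF l2, of "real s"] by (simp add: X_def mult_ac)
        then have "X powr (1 + \<eta>) \<le> (2 * (real s * log 2 (real n))) powr (1 + \<eta>)"
          using X assms by (intro powr_mono2) auto
        also have "\<dots> = 2 powr (1 + \<eta>) * (real s * log 2 (real n)) powr (1 + \<eta>)"
          using ln1 by (intro powr_mult)
        also have "\<dots> \<le> 2 powr 2 * (real s * log 2 (real n)) powr (1 + \<eta>)"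
          using assms by (intro mult_right_mono powr_mono) auto
        finally show ?thesis by simp
      qed
      define k where "k = 9 * c + 3"
      have "real l * real s powr (1 + \<beta>) \<le> X powr (1 + \<beta>)"
      proof -
        have "real l \<le> real l powr (1 + \<beta>)"
          using l1 \<beta> powr_mono[of 1 "1 + \<beta>" "real l"] by simp
        then have "real l * real s powr (1 + \<beta>) \<le> real l powr (1 + \<beta>) * real s powr (1 + \<beta>)"
          by (rule mult_right_mono) simp
        then show ?thesis using s l1 by (simp add: X_def powr_mult mult.commute)
      qed
      then have "(real l * real s powr (1 + \<beta>) * real (u ^ k)) powr (1 + \<beta>)
          \<le> (X powr (1 + \<beta>) * real u ^ k) powr (1 + \<beta>)"
        using \<beta> by (intro powr_mono2 mult_mono) auto
      also have "\<dots> = X powr ((1 + \<beta>) * (1 + \<beta>)) * (real u ^ k) powr (1 + \<beta>)"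
        by (simp add: powr_mult powr_powr)
      also have "\<dots> \<le> X powr (1 + 3 * \<beta>) * (real u ^ k) powr 2"
      proof (intro mult_mono powr_mono)
        have "\<beta> * \<beta> \<le> \<beta> * 1" using \<beta> by (intro mult_left_mono) auto
        then show "(1 + \<beta>) * (1 + \<beta>) \<le> 1 + 3 * \<beta>" by (simp add: algebra_simps)
      qed (use X \<beta> u1 in auto)
      also have "(real u ^ k) powr 2 = real u ^ (2 * k)"
        using u1 by (simp add: powr_numeral mult.commute flip: power_mult)
      finally have "real N \<le> (X powr (1 + 3 * \<beta>) * real u ^ (2 * k)) * real (((9 * c + 10) * u) ^ (8 * c))"
        using N(2) unfolding k_def by (meson mult_right_mono of_nat_0_le_iff order.trans)
      also have "\<dots> = X powr (1 + 3 * \<beta>) * (real ((9 * c + 10) ^ (8 * c)) * real u ^ w')"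
        by (simp only: w'_def k_def power_mult_distrib power_add of_nat_mult of_nat_power mult_ac)
      also have "\<dots> \<le> X powr (1 + 3 * \<beta>) * (real ((9 * c + 10) ^ (8 * c)) * (C1 * X powr \<beta>))"
      proof (intro mult_left_mono)
        have "real u ^ w' \<le> (real u0 + 1 + log 2 X) ^ w'" by (intro power_mono uX) simp
        then show "real u ^ w' \<le> C1 * X powr \<beta>" using C1(2)[OF X(1)] by linarith
      qed auto
      also have "\<dots> = real ((9 * c + 10) ^ (8 * c)) * C1 * X powr (1 + \<eta>)"
        using \<beta>(3) by (simp add: mult_ac add_ac flip: powr_add)
      also have "\<dots> \<le> real ((9 * c + 10) ^ (8 * c)) * C1 * (4 * (real s * log 2 (real n)) powr (1 + \<eta>))"
        using C1(1) by (intro mult_left_mono X4) simp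
      also have "\<dots> = Cn * (real s * log 2 (real n)) powr (1 + \<eta>)"
        by (simp add: Cn_def)
      also have "\<dots> \<le> C * (real s * log 2 (real n)) powr (1 + \<eta>)"
        using C by (intro mult_right_mono) auto
      finally show ?thesis .
    qed
    ultimately show ?thesis using N(1) by blast
  qed

  have "\<exists>t N. 0 < t \<and> PolyEval_has_data_structure n s t \<delta> \<epsilon> lam N \<and>
        (2 \<le> n \<longrightarrow> real t \<le> C * (poly p (log 2 (real s)) * log 2 (real n) powr (1 + h n))) \<and>
        real N \<le> C * (real s * log 2 (real n)) powr (1 + \<eta>)"
    if "1 \<le> s \<and> s \<le> n \<and> 0 \<le> \<delta> \<and> \<delta> \<le> 1 / 128" for s n :: nat and \<delta> :: real
  proof (cases "2 \<le> n")
    case True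
    then show ?thesis using main[of s n \<delta>] that by blast
  next
    case False
    then have "n = 1" using that by linarith
    then show ?thesis using PolyEval_trivial[OF assms(1,3)] C(3)
      by (intro exI[of _ 1] exI[of _ 0]) auto
  qed
  then show ?thesis using h
    by (intro exI[of _ "1 / 128"] exI[of _ C] exI[of _ p] exI[of _ h]) auto
qed

end
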